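(* Let $X$ be a Tychonoff space with an action of a group $G$ as in the context such that the map $x\mapsto gx$ is continuous for each $g\in G$. Let $d:G\times X\to\mathbf F$ be continuous in the variable $x\in X$ for each $g\in G$ and satisfy: $d(e,x)=1$ for each $x$; $d(g,x)\ne0$ for all $g,x$; $d(sg,x)=d(g,s^{-1}x)d(s,x)$ for all $s,g\in G$, $x\in X$. Let $m\in M(X,\mathbf F)$. Then the following conditions are equivalent: (1) for each $f\in C_b(X,\mathbf F)$ and $h\in C(X,\mathbf F)$ with $f\,\Upsilon_d\,h$ the equality $m(f)=m(h)$ holds, where $m(f):=\int_X f(x)\,m(dx)$; (2) $m\in Q^d(X,\mathbf F)$.
   Context: $\mathbf F$ is $\mathbf R$ or $\mathbf C$; $C(X,\mathbf F)$ (resp. $C_b(X,\mathbf F)$) is the space of continuous (resp. bounded continuous) functions. $f\,\Upsilon_d\,h$ means: there is $g\in G$ with $f(x)=d(g,x)h(g^{-1}x)$ for all $x\in X$. $\mathcal F=\mathcal F(X)$ is the smallest algebra of subsets containing all zero sets $f^{-1}(0)$, $f\in C_b(X,\mathbf R)$, and their complements. $G$ (neutral element $e$) acts on $X$ by maps $h_g$ with $h_g\circ h_j=h_{gj}$, $h_e=\mathrm{id}$, $gx=h_g(x)$; standing assumption: each $g$ maps $\mathcal F$ into $\mathcal F$ and $gX=X$. A measure is a bounded finitely additive zero-set regular $m:\mathcal F\to\mathbf F$ (for $A\in\mathcal F$, $\epsilon>0$ there is a zero set $Z\subset A$ with $|m|(A\setminus Z)<\epsilon$, $|m|$ the variation);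 $M(X,\mathbf F)$ is the set of measures. $m^g(A):=m(g^{-1}A)$. $m$ is quasi-invariant relative to $G$ if $m^g$ and $m$ are equivalent ($|m^g|(A)=0\Leftrightarrow|m|(A)=0$) for each $g$; its quasi-invariance factor is $d_m(g,x)=m^g(dx)/m(dx)$ (density of $m^g$ with respect to $m$) where it exists. $Q^d(X,\mathbf F)$ is the set of quasi-invariant measures $m\in M(X,\mathbf F)$ whose quasi-invariance factor exists with $d_m(g,x)=d(g,x)$ for each $g\in G$ and $m$-almost all $x\in X$. *)

theory Defs
  imports "HOL-Analysis.Analysis" "HOL-Algebra.Group_Action"
begin

text \<open>
  The scalars are represented by a type of class \<^class>\<open>real_normed_field\<close> and
  \<^class>\<open>euclidean_space\<close>. Both \<^typ>\<open>real\<close> and \<^typ>\<open>complex\<close> are instances, and by the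
  Gelfand--Mazur theorem there are no others up to isometric isomorphism.
\<close>

section \<open>Continuous functions and the algebra generated by the zero sets\<close>

definition Tychonoff_space :: "'a topology \<Rightarrow> bool" where
  "Tychonoff_space X \<longleftrightarrow> completely_regular_space X \<and> Hausdorff_space X"

definition cont_funs :: "'a topology \<Rightarrow> ('a \<Rightarrow> 'f::real_normed_vector) set" where
  "cont_funs X = {f. continuous_map X euclidean f}"

definition bdd_cont_funs :: "'a topology \<Rightarrow> ('a \<Rightarrow> 'f::real_normed_vector) set" where
  "bdd_cont_funs X = {f \<in> cont_funs X. bounded (f ` topspace X)}"

definition zero_sets :: "'a topology \<Rightarrow> 'a set set" where
  "zero_sets X = {{x \<in> topspace X. f x = 0} |f::'a \<Rightarrow> real. f \<in> bdd_cont_funs X}"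

definition zero_set_algebra :: "'a topology \<Rightarrow> 'a set set" where
  "zero_set_algebra X =
     \<Inter>{M. Sigma_Algebra.algebra (topspace X) M \<and>
           zero_sets X \<subseteq> M \<and> (\<lambda>Z. topspace X - Z) ` zero_sets X \<subseteq> M}"


section \<open>Finitely additive zero-set regular measures\<close>

text \<open>
  The values of a set function outside \<^term>\<open>zero_set_algebra X\<close> are irrelevant.
  The supremum below is taken in the reals; it is finite for every bounded finitely additive
  scalar-valued set function on an algebra, and the variation is only meaningful for
  arguments in \<^term>\<open>zero_set_algebra X\<close>.
\<close>

definition variation :: "'a topology \<Rightarrow> ('a set \<Rightarrow> 'f::real_normed_vector) \<Rightarrow> 'a set \<Rightarrow> real" where
  "variation X m A =
     (SUP P \<in> {P. finite P \<and> P \<subseteq> zero_set_algebra X \<and> partition_on A P}. \<Sum>B\<in>P. norm (m B))"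

definition reg_measures :: "'a topology \<Rightarrow> ('a set \<Rightarrow> 'f::real_normed_field) set" where
  "reg_measures X = {m.
     Measure_Space.additive (zero_set_algebra X) m \<and>
     bounded (m ` zero_set_algebra X) \<and>
     (\<forall>A\<in>zero_set_algebra X. \<forall>\<epsilon>>0. \<exists>Z\<in>zero_sets X. Z \<subseteq> A \<and> variation X m (A - Z) < \<epsilon>)}"

definition outer_variation :: "'a topology \<Rightarrow> ('a set \<Rightarrow> 'f::real_normed_vector) \<Rightarrow> 'a set \<Rightarrow> real" where
  "outer_variation X m E = (INF A \<in> {A \<in> zero_set_algebra X. E \<subseteq> A}. variation X m A)"

definition almost_all :: "'a topology \<Rightarrow> ('a set \<Rightarrow> 'f::real_normed_vector) \<Rightarrow> ('a \<Rightarrow> bool) \<Rightarrow> bool" where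
  "almost_all X m P \<longleftrightarrow> outer_variation X m {x \<in> topspace X. \<not> P x} = 0"


section \<open>The Dunford--Schwartz integral\<close>

text \<open>
  Integration with respect to a finitely additive measure: a function is integrable if it is the
  limit in \<^term>\<open>m\<close>-measure of a sequence of simple functions that is Cauchy in the mean with
  respect to the variation. Unbounded functions may or may not be integrable.
\<close>

definition simple_fun :: "'a topology \<Rightarrow> ('a \<Rightarrow> 'b) \<Rightarrow> bool" where
  "simple_fun X s \<longleftrightarrow>
     finite (s ` topspace X) \<and> (\<forall>y. {x \<in> topspace X. s x = y} \<in> zero_set_algebra X)"

definition simple_int :: "'a topology \<Rightarrow> ('a set \<Rightarrow> 'f::real_normed_field) \<Rightarrow> ('a \<Rightarrow> 'f) \<Rightarrow> 'f" where
  "simple_int X m s = (\<Sum>y\<in>s ` topspace X. y * m {x \<in> topspace X. s x = y})"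

definition has_int ::
  "'a topology \<Rightarrow> ('a set \<Rightarrow> 'f::real_normed_field) \<Rightarrow> ('a \<Rightarrow> 'f) \<Rightarrow> 'f \<Rightarrow> bool" where
  "has_int X m f I \<longleftrightarrow> (\<exists>s :: nat \<Rightarrow> 'a \<Rightarrow> 'f.
     (\<forall>n. simple_fun X (s n)) \<and>
     (\<forall>\<epsilon>>0. (\<lambda>n. outer_variation X m {x \<in> topspace X. norm (s n x - f x) > \<epsilon>}) \<longlonglongrightarrow> 0) \<and>
     (\<forall>\<epsilon>>0. \<exists>N. \<forall>n\<ge>N. \<forall>k\<ge>N.
        simple_int X (variation X m) (\<lambda>x. norm (s n x - s k x)) < \<epsilon>) \<and>
     (\<lambda>n. simple_int X m (s n)) \<longlonglongrightarrow> I)"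

definition int_exists :: "'a topology \<Rightarrow> ('a set \<Rightarrow> 'f::real_normed_field) \<Rightarrow> ('a \<Rightarrow> 'f) \<Rightarrow> bool" where
  "int_exists X m f \<longleftrightarrow> (\<exists>I. has_int X m f I)"

definition int_over :: "'a topology \<Rightarrow> ('a set \<Rightarrow> 'f::real_normed_field) \<Rightarrow> ('a \<Rightarrow> 'f) \<Rightarrow> 'f" where
  "int_over X m f = (THE I. has_int X m f I)"

definition has_density ::
  "'a topology \<Rightarrow> ('a set \<Rightarrow> 'f::real_normed_field) \<Rightarrow> ('a set \<Rightarrow> 'f) \<Rightarrow> ('a \<Rightarrow> 'f) \<Rightarrow> bool" where
  "has_density X \<mu> m \<rho> \<longleftrightarrow>
     (\<forall>A\<in>zero_set_algebra X.
        int_exists X m (\<lambda>x. indicator A x *\<^sub>R \<rho> x) \<and>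
        \<mu> A = int_over X m (\<lambda>x. indicator A x *\<^sub>R \<rho> x))"


section \<open>Quasi-invariance\<close>

definition translate ::
  "('g, 'r) monoid_scheme \<Rightarrow> ('g \<Rightarrow> 'a \<Rightarrow> 'a) \<Rightarrow> ('a set \<Rightarrow> 'f) \<Rightarrow> 'g \<Rightarrow> 'a set \<Rightarrow> 'f" where
  "translate G act m g A = m (act (inv\<^bsub>G\<^esub> g) ` A)"

definition equivalent_measures ::
  "'a topology \<Rightarrow> ('a set \<Rightarrow> 'f::real_normed_vector) \<Rightarrow> ('a set \<Rightarrow> 'f) \<Rightarrow> bool" where
  "equivalent_measures X \<mu> m \<longleftrightarrow>
     (\<forall>A\<in>zero_set_algebra X. variation X \<mu> A = 0 \<longleftrightarrow> variation X m A = 0)"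

definition quasi_invariant ::
  "'a topology \<Rightarrow> ('g, 'r) monoid_scheme \<Rightarrow> ('g \<Rightarrow> 'a \<Rightarrow> 'a) \<Rightarrow>
    ('a set \<Rightarrow> 'f::real_normed_field) \<Rightarrow> bool" where
  "quasi_invariant X G act m \<longleftrightarrow>
     (\<forall>g\<in>carrier G. equivalent_measures X (translate G act m g) m)"

text \<open>
  The quasi-invariance factor is a density and hence not a uniquely determined function; the
  requirement is that some version of it agrees with \<^term>\<open>d\<close> almost everywhere.
\<close>

definition quasi_invariant_measures ::
  "'a topology \<Rightarrow> ('g, 'r) monoid_scheme \<Rightarrow> ('g \<Rightarrow> 'a \<Rightarrow> 'a) \<Rightarrow> ('g \<Rightarrow> 'a \<Rightarrow> 'f) \<Rightarrow>
    ('a set \<Rightarrow> 'f::real_normed_field) set" where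
  "quasi_invariant_measures X G act d = {m \<in> reg_measures X.
     quasi_invariant X G act m \<and>
     (\<exists>dm :: 'g \<Rightarrow> 'a \<Rightarrow> 'f. \<forall>g\<in>carrier G.
        has_density X (translate G act m g) m (dm g) \<and>
        almost_all X m (\<lambda>x. dm g x = d g x))}"

definition related ::
  "'a topology \<Rightarrow> ('g, 'r) monoid_scheme \<Rightarrow> ('g \<Rightarrow> 'a \<Rightarrow> 'a) \<Rightarrow> ('g \<Rightarrow> 'a \<Rightarrow> 'f::real_normed_field) \<Rightarrow>
    ('a \<Rightarrow> 'f) \<Rightarrow> ('a \<Rightarrow> 'f) \<Rightarrow> bool" where
  "related X G act d f h \<longleftrightarrow>
     (\<exists>g\<in>carrier G. \<forall>x\<in>topspace X. f x = d g x * h (act (inv\<^bsub>G\<^esub> g) x))"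

end

theory Submission
  imports Defs
begin

text \<open>
  If \<open>f\<close> and \<open>h\<close> are related through \<open>g\<close>, the cocycle
  identity gives \<open>h x = d (g\<^sup>-\<^sup>1) x * f (g x)\<close>. With the inverse of
  \<open>g\<close> in place of \<open>g\<close> and \<open>f x = w (g x)\<close>, the first
  condition therefore says, besides the existence of the integrals, that for every group element
  \<open>g\<close> and every bounded continuous \<open>w\<close> the integral of
  \<open>\<lambda>x. w (g x)\<close> equals that of \<open>\<lambda>x. w x * d g x\<close>. The
  former is the integral of \<open>w\<close> against the translate of the measure by
  \<open>g\<close>, the latter the integral of \<open>w\<close> against the indefinite integral of
  \<open>d g\<close>.

  If \<open>d g\<close> agrees almost everywhere with a density of the translate, the two
  integrals agree because \<open>w\<close> is a uniform limit of simple functions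
  (\<open>int_transport_density\<close>). Conversely, under the first condition \<open>w =
  (\<lambda>x. 1)\<close> shows that \<open>d g\<close> is integrable, and the two charges
  coincide because a regular charge is determined by the integrals of bounded continuous functions
  (\<open>regular_charge_eq_0\<close>, \<open>transport_eq_density_charge\<close>). Absolute
  continuity of the indefinite integrals then shows that a set of variation zero is also null for
  the translate, and the same for the inverse group element gives the converse.

  Both directions rest on the integral of finitely additive measures: its independence of the
  approximating sequence (\<open>has_int_unique\<close>), and the fact that products of integrable
  functions with uniform limits of simple functions are integrable and satisfy the change of
  measure formula (\<open>determining_mult\<close>, \<open>density_charge_uniform_limit\<close>).
\<close>

section \<open>The algebra generated by the zero sets\<close>

lemma algebra_zero_set_algebra: "Sigma_Algebra.algebra (topspace X) (zero_set_algebra X)"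
proof -
  have Pow: "Sigma_Algebra.algebra (topspace X) (Pow (topspace X))"
    by (rule algebra_Pow)
  have sub: "zero_sets X \<subseteq> Pow (topspace X)"
    by (auto simp: zero_sets_def)
  show ?thesis
    unfolding algebra_iff_Un
  proof (intro conjI ballI)
    show "zero_set_algebra X \<subseteq> Pow (topspace X)"
      unfolding zero_set_algebra_def using Pow sub by (intro Inter_lower) auto
    show "{} \<in> zero_set_algebra X"
      unfolding zero_set_algebra_def by (rule InterI) (simp add: algebra_iff_Un)
    show "topspace X - A \<in> zero_set_algebra X" if "A \<in> zero_set_algebra X" for A
      unfolding zero_set_algebra_def
    proof (rule InterI)
      fix M assume M: "M \<in> {M. Sigma_Algebra.algebra (topspace X) M \<and> zero_sets X \<subseteq> M \<and>
        (\<lambda>Z. topspace X - Z) ` zero_sets X \<subseteq> M}"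
      then have "A \<in> M"
        using that by (simp add: zero_set_algebra_def)
      with M show "topspace X - A \<in> M"
        by (simp add: algebra_iff_Un)
    qed
    show "A \<union> B \<in> zero_set_algebra X" if "A \<in> zero_set_algebra X" "B \<in> zero_set_algebra X" for A B
      unfolding zero_set_algebra_def
    proof (rule InterI)
      fix M assume M: "M \<in> {M. Sigma_Algebra.algebra (topspace X) M \<and> zero_sets X \<subseteq> M \<and>
        (\<lambda>Z. topspace X - Z) ` zero_sets X \<subseteq> M}"
      then have "A \<in> M" "B \<in> M"
        using that by (simp_all add: zero_set_algebra_def)
      with M show "A \<union> B \<in> M"
        by (simp add: algebra_iff_Un)
    qed
  qed
qed

interpretation zsa: Sigma_Algebra.algebra "topspace X" "zero_set_algebra X" for X
  by (rule algebra_zero_set_algebra)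

lemma zero_sets_subset_algebra: "zero_sets X \<subseteq> zero_set_algebra X"
  by (auto simp: zero_set_algebra_def)

lemma zero_setsI:
  fixes f :: "'a \<Rightarrow> real"
  assumes "continuous_map X euclidean f" "bounded (f ` topspace X)"
  shows "{x \<in> topspace X. f x = 0} \<in> zero_sets X"
  using assms unfolding zero_sets_def bdd_cont_funs_def cont_funs_def by blast

lemma zero_sets_Un:
  assumes "A \<in> zero_sets X" "B \<in> zero_sets X"
  shows "A \<union> B \<in> zero_sets X"
proof -
  obtain f where f: "A = {x \<in> topspace X. f x = (0::real)}" "continuous_map X euclidean f"
      "bounded (f ` topspace X)"
    using assms(1) by (auto simp: zero_sets_def bdd_cont_funs_def cont_funs_def)
  obtain g where g: "B = {x \<in> topspace X. g x = (0::real)}" "continuous_map X euclidean g"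
      "bounded (g ` topspace X)"
    using assms(2) by (auto simp: zero_sets_def bdd_cont_funs_def cont_funs_def)
  have "continuous_map X euclidean (\<lambda>x. f x * g x)"
    using f g by (auto intro!: continuous_intros)
  moreover have "bounded ((\<lambda>x. f x * g x) ` topspace X)"
  proof -
    obtain a b where "\<And>x. x \<in> topspace X \<Longrightarrow> norm (f x) \<le> a"
      "\<And>x. x \<in> topspace X \<Longrightarrow> norm (g x) \<le> b"
      using f(3) g(3) by (auto simp: bounded_iff)
    then have "norm (f x * g x) \<le> a * b" if "x \<in> topspace X" for x
      using that unfolding norm_mult by (meson mult_mono norm_ge_zero order_trans)
    then show ?thesis
      by (auto simp: bounded_iff)
  qed
  moreover have "A \<union> B = {x \<in> topspace X. f x * g x = 0}"
    using f g by auto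
  ultimately show ?thesis
    using zero_setsI[of X "\<lambda>x. f x * g x"] by simp
qed

section \<open>The variation of a bounded charge\<close>

lemma additive_empty:
  fixes \<mu> :: "'a set \<Rightarrow> 'b::ab_group_add"
  assumes "Measure_Space.additive (zero_set_algebra X) \<mu>"
  shows "\<mu> {} = 0"
  using assms zsa.empty_sets[of X] unfolding Measure_Space.additive_def
  by (metis Int_empty_left Un_empty_left add_cancel_right_left)

lemma additive_Un:
  assumes "Measure_Space.additive (zero_set_algebra X) \<mu>"
    and "A \<in> zero_set_algebra X" "B \<in> zero_set_algebra X" "A \<inter> B = {}"
  shows "\<mu> (A \<union> B) = \<mu> A + \<mu> B"
  using assms by (auto simp: Measure_Space.additive_def)

lemma additive_UN:
  fixes \<mu> :: "'a set \<Rightarrow> 'b::ab_group_add"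
  assumes add: "Measure_Space.additive (zero_set_algebra X) \<mu>"
    and "finite I" "\<And>i. i \<in> I \<Longrightarrow> E i \<in> zero_set_algebra X" "disjoint_family_on E I"
  shows "\<mu> (\<Union>i\<in>I. E i) = (\<Sum>i\<in>I. \<mu> (E i))"
  using assms(2-4)
proof (induction I rule: finite_induct)
  case empty
  then show ?case by (simp add: additive_empty[OF add])
next
  case (insert i I)
  have "E i \<inter> (\<Union>j\<in>I. E j) = {}"
    using insert.prems(2) insert.hyps(2) by (auto simp: disjoint_family_on_def)
  moreover have "(\<Union>j\<in>I. E j) \<in> zero_set_algebra X"
    using insert by (intro zsa.finite_UN) auto
  ultimately show ?case
    using insert by (simp add: additive_Un[OF add] disjoint_family_on_def)
qed

text \<open>
  Bounded finitely additive scalar-valued set functions on the algebra generated by the zero sets.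
  Regularity is left out, since the integration theory does not need it.
\<close>

locale bounded_charge =
  fixes X :: "'a topology" and m :: "'a set \<Rightarrow> 'f::{real_normed_field, euclidean_space}"
  assumes additive: "Measure_Space.additive (zero_set_algebra X) m"
    and bounded: "bounded (m ` zero_set_algebra X)"
begin

text \<open>
  Finite dimension of the scalars enters here: the sum of the norms of finitely many vectors is
  controlled by the norms of all their partial sums, which are values of the charge.
\<close>

lemma partition_sum_le:
  assumes "finite P" "P \<subseteq> zero_set_algebra X" "partition_on A P"
    and c: "\<And>C. C \<in> zero_set_algebra X \<Longrightarrow> C \<subseteq> A \<Longrightarrow> norm (m C) \<le> c"
  shows "(\<Sum>B\<in>P. norm (m B)) \<le> 2 * real DIM('f) * c"
proof (rule sum_norm_allsubsets_bound[OF assms(1)])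
  fix Q assume Q: "Q \<subseteq> P"
  then have "finite Q" "Q \<subseteq> zero_set_algebra X"
    using assms finite_subset by auto
  moreover have "disjoint_family_on id Q"
    using assms(3) Q by (auto simp: disjoint_family_on_def partition_on_def pairwise_def disjnt_def)
  ultimately have "m (\<Union>Q) = sum m Q"
    using additive_UN[OF additive, of Q id] by auto
  moreover have "\<Union>Q \<in> zero_set_algebra X" "\<Union>Q \<subseteq> A"
    using \<open>finite Q\<close> \<open>Q \<subseteq> zero_set_algebra X\<close> Q assms(3) by (auto simp: partition_on_def)
  ultimately show "norm (sum m Q) \<le> c"
    using c[of "\<Union>Q"] by simp
qed

lemma variation_bdd_above:
  "bdd_above ((\<lambda>P. \<Sum>B\<in>P. norm (m B)) ` {P. finite P \<and> P \<subseteq> zero_set_algebra X \<and> partition_on A P})"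
proof -
  obtain c where "\<And>C. C \<in> zero_set_algebra X \<Longrightarrow> norm (m C) \<le> c"
    using bounded by (auto simp: bounded_iff)
  then show ?thesis
    by (intro bdd_aboveI2[where M = "2 * real DIM('f) * c"] partition_sum_le[where A = A]) auto
qed

lemma variation_least:
  assumes "A \<in> zero_set_algebra X"
    and "\<And>P. finite P \<Longrightarrow> P \<subseteq> zero_set_algebra X \<Longrightarrow> partition_on A P \<Longrightarrow> (\<Sum>B\<in>P. norm (m B)) \<le> c"
  shows "variation X m A \<le> c"
  unfolding variation_def
proof (rule cSUP_least)
  have "(if A = {} then {} else {A}) \<in> {P. finite P \<and> P \<subseteq> zero_set_algebra X \<and> partition_on A P}"
    using assms(1) by (auto simp: partition_on_def)
  then show "{P. finite P \<and> P \<subseteq> zero_set_algebra X \<and> partition_on A P} \<noteq> {}"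
    by blast
qed (use assms in auto)

text \<open>
  Empty members are allowed in the family, and it need not cover the set; this is what makes the
  estimate convenient for families obtained by intersecting a partition with a set.
\<close>

lemma sum_norm_le_variation:
  assumes "finite I" "\<And>i. i \<in> I \<Longrightarrow> E i \<in> zero_set_algebra X" "disjoint_family_on E I"
    and "A \<in> zero_set_algebra X" "(\<Union>i\<in>I. E i) \<subseteq> A"
  shows "(\<Sum>i\<in>I. norm (m (E i))) \<le> variation X m A"
proof -
  define P where "P = insert (A - (\<Union>i\<in>I. E i)) (E ` I) - {{}}"
  have UN: "(\<Union>i\<in>I. E i) \<in> zero_set_algebra X"
    using assms by (intro zsa.finite_UN) auto
  have fin: "finite P"
    unfolding P_def using assms(1) by simp
  have "A - (\<Union>i\<in>I. E i) \<in> zero_set_algebra X"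
    using assms(4) UN by (rule zsa.Diff)
  then have sub: "P \<subseteq> zero_set_algebra X"
    unfolding P_def using assms(2) by blast
  have "partition_on A P"
  proof (rule partition_onI)
    have "\<Union>P = \<Union>(insert (A - (\<Union>i\<in>I. E i)) (E ` I))"
      unfolding P_def by blast
    also have "\<dots> = A"
      using assms(5) by (simp add: Un_absorb2)
    finally show "\<Union>P = A" .
    show "disjnt p q" if "p \<in> P" "q \<in> P" "p \<noteq> q" for p q
    proof -
      have "disjnt (E i) (E j)" if "i \<in> I" "j \<in> I" "E i \<noteq> E j" for i j
      proof -
        have "i \<noteq> j"
          using that(3) by blast
        then show ?thesis
          using disjoint_family_onD[OF assms(3) that(1,2)] by (simp add: disjnt_def)
      qed
      moreover have "disjnt (A - (\<Union>i\<in>I. E i)) (E i)" "disjnt (E i) (A - (\<Union>i\<in>I. E i))"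
        if "i \<in> I" for i
        using that by (auto simp: disjnt_def)
      ultimately show ?thesis
        using that unfolding P_def by (elim DiffE insertE imageE) simp_all
    qed
  qed (simp add: P_def)
  have "(\<Sum>i\<in>I. norm (m (E i))) = (\<Sum>B\<in>E ` I. norm (m B))"
  proof (rule sum.reindex_nontrivial[symmetric, unfolded comp_def])
    fix i j assume "i \<in> I" "j \<in> I" "i \<noteq> j" "E i = E j"
    then have "E i = {}"
      using disjoint_family_onD[OF assms(3), of i j] by simp
    then show "norm (m (E i)) = 0"
      by (simp add: additive_empty[OF additive])
  qed (rule assms)
  also have "\<dots> = (\<Sum>B\<in>E ` I - {{}}. norm (m B))"
    using assms(1) by (intro sum.mono_neutral_right) (auto simp: additive_empty[OF additive])
  also have "\<dots> \<le> (\<Sum>B\<in>P. norm (m B))"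
    using fin by (intro sum_mono2) (auto simp: P_def)
  also have "\<dots> \<le> variation X m A"
    unfolding variation_def using fin sub \<open>partition_on A P\<close>
    by (intro cSUP_upper variation_bdd_above) auto
  finally show ?thesis .
qed

lemma norm_le_variation:
  assumes "A \<in> zero_set_algebra X" "B \<in> zero_set_algebra X" "B \<subseteq> A"
  shows "norm (m B) \<le> variation X m A"
  using sum_norm_le_variation[of "{B}" id A] assms by (auto simp: disjoint_family_on_def)

lemma variation_nonneg: "A \<in> zero_set_algebra X \<Longrightarrow> 0 \<le> variation X m A"
  using sum_norm_le_variation[of "{}" id A] by (auto simp: disjoint_family_on_def)

lemma variation_le_bound:
  assumes "A \<in> zero_set_algebra X"
    and "\<And>C. C \<in> zero_set_algebra X \<Longrightarrow> C \<subseteq> A \<Longrightarrow> norm (m C) \<le> c"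
  shows "variation X m A \<le> 2 * real DIM('f) * c"
  by (rule variation_least) (use assms partition_sum_le in auto)

text \<open>
  This criterion reduces the equivalence of two charges to statements about their values, so that
  the variation of an indefinite integral never has to be computed.
\<close>

lemma variation_eq_0_iff:
  assumes "A \<in> zero_set_algebra X"
  shows "variation X m A = 0 \<longleftrightarrow> (\<forall>B\<in>zero_set_algebra X. B \<subseteq> A \<longrightarrow> m B = 0)"
proof
  assume "variation X m A = 0"
  then show "\<forall>B\<in>zero_set_algebra X. B \<subseteq> A \<longrightarrow> m B = 0"
    using norm_le_variation[OF assms] by fastforce
next
  assume "\<forall>B\<in>zero_set_algebra X. B \<subseteq> A \<longrightarrow> m B = 0"
  then show "variation X m A = 0"
    using variation_le_bound[OF assms, of 0] variation_nonneg[OF assms] by auto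
qed

lemma variation_additive: "Measure_Space.additive (zero_set_algebra X) (variation X m)"
  unfolding Measure_Space.additive_def
proof (intro ballI impI antisym)
  fix A B assume AB: "A \<in> zero_set_algebra X" "B \<in> zero_set_algebra X" "A \<inter> B = {}"
  show "variation X m (A \<union> B) \<le> variation X m A + variation X m B"
  proof (rule variation_least)
    fix P assume P: "finite P" "P \<subseteq> zero_set_algebra X" "partition_on (A \<union> B) P"
    have disj: "disjoint_family_on (\<lambda>C. C \<inter> D) P" for D
      using P(3) by (auto simp: disjoint_family_on_def partition_on_def pairwise_def disjnt_def)
    have "(\<Sum>C\<in>P. norm (m C)) \<le> (\<Sum>C\<in>P. norm (m (C \<inter> A)) + norm (m (C \<inter> B)))"
    proof (rule sum_mono)
      fix C assume "C \<in> P"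
      then have "C = (C \<inter> A) \<union> (C \<inter> B)" "C \<in> zero_set_algebra X"
        using P by (auto simp: partition_on_def)
      moreover have "m ((C \<inter> A) \<union> (C \<inter> B)) = m (C \<inter> A) + m (C \<inter> B)"
        using AB \<open>C \<in> zero_set_algebra X\<close> by (intro additive_Un[OF additive]) auto
      ultimately show "norm (m C) \<le> norm (m (C \<inter> A)) + norm (m (C \<inter> B))"
        by (metis norm_triangle_ineq)
    qed
    also have "\<dots> = (\<Sum>C\<in>P. norm (m (C \<inter> A))) + (\<Sum>C\<in>P. norm (m (C \<inter> B)))"
      by (rule sum.distrib)
    also have "\<dots> \<le> variation X m A + variation X m B"
      using P AB disj by (intro add_mono sum_norm_le_variation) auto
    finally show "(\<Sum>C\<in>P. norm (m C)) \<le> variation X m A + variation X m B" .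
  qed (use AB in auto)
  have "variation X m A \<le> variation X m (A \<union> B) - variation X m B"
  proof (rule variation_least)
    fix P assume P: "finite P" "P \<subseteq> zero_set_algebra X" "partition_on A P"
    have "variation X m B \<le> variation X m (A \<union> B) - (\<Sum>C\<in>P. norm (m C))"
    proof (rule variation_least)
      fix Q assume Q: "finite Q" "Q \<subseteq> zero_set_algebra X" "partition_on B Q"
      have PQ: "C \<inter> D = {}" if "C \<in> P" "D \<in> Q" for C D
        using that AB(3) partition_onD1[OF P(3)] partition_onD1[OF Q(3)] by fast
      then have "P \<inter> Q = {}"
        using partition_onD3[OF P(3)] by fastforce
      have "disjoint_family_on (\<lambda>C. C) (P \<union> Q)"
        unfolding disjoint_family_on_def
      proof (intro ballI impI)
        fix C D assume "C \<in> P \<union> Q" "D \<in> P \<union> Q" "C \<noteq> D"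
        then show "C \<inter> D = {}"
          using PQ[of C D] PQ[of D C] disjointD[OF partition_onD2[OF P(3)], of C D]
            disjointD[OF partition_onD2[OF Q(3)], of C D] by (auto simp: Int_commute)
      qed
      then have "(\<Sum>C\<in>P \<union> Q. norm (m C)) \<le> variation X m (A \<union> B)"
        using P Q AB by (intro sum_norm_le_variation) (auto simp: partition_on_def)
      moreover have "(\<Sum>C\<in>P \<union> Q. norm (m C)) = (\<Sum>C\<in>P. norm (m C)) + (\<Sum>C\<in>Q. norm (m C))"
        using P(1) Q(1) \<open>P \<inter> Q = {}\<close> by (rule sum.union_disjoint)
      ultimately show "(\<Sum>C\<in>Q. norm (m C)) \<le> variation X m (A \<union> B) - (\<Sum>C\<in>P. norm (m C))"
        by simp
    qed (rule AB)
    then show "(\<Sum>C\<in>P. norm (m C)) \<le> variation X m (A \<union> B) - variation X m B"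
      by simp
  qed (rule AB)
  then show "variation X m A + variation X m B \<le> variation X m (A \<union> B)"
    by simp
qed

lemma variation_mono:
  assumes "A \<in> zero_set_algebra X" "B \<in> zero_set_algebra X" "A \<subseteq> B"
  shows "variation X m A \<le> variation X m B"
proof -
  have "variation X m (A \<union> (B - A)) = variation X m A + variation X m (B - A)"
    using assms by (intro additive_Un[OF variation_additive]) auto
  moreover have "A \<union> (B - A) = B"
    using assms by auto
  ultimately show ?thesis
    using variation_nonneg[of "B - A"] assms by auto
qed

lemma variation_Un_le:
  assumes "A \<in> zero_set_algebra X" "B \<in> zero_set_algebra X"
  shows "variation X m (A \<union> B) \<le> variation X m A + variation X m B"
proof -
  have "variation X m (A \<union> (B - A)) = variation X m A + variation X m (B - A)"
    using assms by (intro additive_Un[OF variation_additive]) auto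
  moreover have "variation X m (B - A) \<le> variation X m B"
    using assms by (intro variation_mono) auto
  ultimately show ?thesis
    by simp
qed

lemma outer_variation_bdd_below:
  "bdd_below (variation X m ` {A \<in> zero_set_algebra X. E \<subseteq> A})"
  using variation_nonneg by (intro bdd_belowI2[where m = 0]) auto

lemma outer_variation_le:
  assumes "A \<in> zero_set_algebra X" "E \<subseteq> A"
  shows "outer_variation X m E \<le> variation X m A"
  unfolding outer_variation_def using assms by (intro cINF_lower outer_variation_bdd_below) auto

lemma outer_variation_nonneg: "E \<subseteq> topspace X \<Longrightarrow> 0 \<le> outer_variation X m E"
  unfolding outer_variation_def using variation_nonneg zsa.top[of X] by (intro cINF_greatest) auto

lemma outer_variation_eq: "A \<in> zero_set_algebra X \<Longrightarrow> outer_variation X m A = variation X m A"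
  unfolding outer_variation_def
  by (intro antisym cINF_lower outer_variation_bdd_below cINF_greatest) (auto intro: variation_mono)

lemma outer_variation_empty: "outer_variation X m {} = 0"
  using outer_variation_eq[OF zsa.empty_sets] variation_eq_0_iff[OF zsa.empty_sets]
    additive_empty[OF additive] by simp

lemma outer_variation_mono:
  assumes "E \<subseteq> F" "F \<subseteq> topspace X"
  shows "outer_variation X m E \<le> outer_variation X m F"
proof -
  have "topspace X \<in> {A \<in> zero_set_algebra X. F \<subseteq> A}"
    using assms(2) zsa.top[of X] by simp
  then show ?thesis
    unfolding outer_variation_def[of _ _ F] using assms(1)
    by (intro cINF_greatest outer_variation_le) auto
qed

lemma outer_variation_Un_le:
  assumes "E \<subseteq> topspace X" "F \<subseteq> topspace X"
  shows "outer_variation X m (E \<union> F) \<le> outer_variation X m E + outer_variation X m F"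
proof -
  have "outer_variation X m (E \<union> F) - variation X m B \<le> outer_variation X m E"
    if B: "B \<in> zero_set_algebra X" "F \<subseteq> B" for B
    unfolding outer_variation_def[of _ _ E]
  proof (rule cINF_greatest)
    fix A assume A: "A \<in> {A \<in> zero_set_algebra X. E \<subseteq> A}"
    then have "outer_variation X m (E \<union> F) \<le> variation X m (A \<union> B)"
      using B by (intro outer_variation_le) auto
    also have "\<dots> \<le> variation X m A + variation X m B"
      using A B by (intro variation_Un_le) auto
    finally show "outer_variation X m (E \<union> F) - variation X m B \<le> variation X m A"
      by simp
  next
    have "topspace X \<in> {A \<in> zero_set_algebra X. E \<subseteq> A}"
      using assms(1) zsa.top[of X] by simp
    then show "{A \<in> zero_set_algebra X. E \<subseteq> A} \<noteq> {}"
      by blast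
  qed
  note * = this
  have "outer_variation X m (E \<union> F) - outer_variation X m E \<le> outer_variation X m F"
    unfolding outer_variation_def[of _ _ F]
  proof (rule cINF_greatest)
    fix B assume "B \<in> {B \<in> zero_set_algebra X. F \<subseteq> B}"
    then show "outer_variation X m (E \<union> F) - outer_variation X m E \<le> variation X m B"
      using *[of B] by simp
  next
    have "topspace X \<in> {B \<in> zero_set_algebra X. F \<subseteq> B}"
      using assms(2) zsa.top[of X] by simp
    then show "{B \<in> zero_set_algebra X. F \<subseteq> B} \<noteq> {}"
      by blast
  qed
  then show ?thesis
    by simp
qed

end

section \<open>Simple functions\<close>

lemma simple_fun_compose:
  assumes "simple_fun X p"
  shows "simple_fun X (\<lambda>x. \<phi> (p x))"
  unfolding simple_fun_def
proof (intro conjI allI)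
  have fin: "finite (p ` topspace X)"
    using assms by (simp add: simple_fun_def)
  have "(\<lambda>x. \<phi> (p x)) ` topspace X = \<phi> ` p ` topspace X"
    by (simp add: image_image)
  then show "finite ((\<lambda>x. \<phi> (p x)) ` topspace X)"
    using fin by simp
  fix y
  have "{x \<in> topspace X. \<phi> (p x) = y}
      = (\<Union>c\<in>{c \<in> p ` topspace X. \<phi> c = y}. {x \<in> topspace X. p x = c})"
    by auto
  also have "\<dots> \<in> zero_set_algebra X"
    using assms fin by (intro zsa.finite_UN) (simp_all add: simple_fun_def)
  finally show "{x \<in> topspace X. \<phi> (p x) = y} \<in> zero_set_algebra X" .
qed

lemma simple_fun_Pair:
  assumes "simple_fun X s" "simple_fun X t"
  shows "simple_fun X (\<lambda>x. (s x, t x))"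
  unfolding simple_fun_def
proof (intro conjI allI)
  have "(\<lambda>x. (s x, t x)) ` topspace X \<subseteq> (s ` topspace X) \<times> (t ` topspace X)"
    by blast
  then show "finite ((\<lambda>x. (s x, t x)) ` topspace X)"
    using assms by (metis finite_SigmaI finite_subset simple_fun_def)
  fix y
  have "{x \<in> topspace X. (s x, t x) = y} = {x \<in> topspace X. s x = fst y} \<inter> {x \<in> topspace X. t x = snd y}"
    by force
  also have "\<dots> \<in> zero_set_algebra X"
    using assms by (intro zsa.Int) (simp_all add: simple_fun_def)
  finally show "{x \<in> topspace X. (s x, t x) = y} \<in> zero_set_algebra X" .
qed

lemma simple_fun_compose2:
  assumes "simple_fun X s" "simple_fun X t"
  shows "simple_fun X (\<lambda>x. \<phi> (s x) (t x))"
  using simple_fun_compose[OF simple_fun_Pair[OF assms], of "\<lambda>p. \<phi> (fst p) (snd p)"] by simp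

lemma simple_fun_Collect:
  assumes "simple_fun X s"
  shows "{x \<in> topspace X. P (s x)} \<in> zero_set_algebra X"
proof -
  have "{x \<in> topspace X. P (s x) = True} \<in> zero_set_algebra X"
    using simple_fun_compose[OF assms, of P] unfolding simple_fun_def by blast
  then show ?thesis
    by simp
qed

lemma simple_fun_const: "simple_fun X (\<lambda>x. c)"
  unfolding simple_fun_def
proof (intro conjI allI)
  show "finite ((\<lambda>x. c) ` topspace X)"
    by (rule finite_subset[of _ "{c}"]) auto
  show "{x \<in> topspace X. c = y} \<in> zero_set_algebra X" for y
    by (cases "c = y") simp_all
qed

lemma simple_fun_indicator:
  assumes "A \<in> zero_set_algebra X"
  shows "simple_fun X (\<lambda>x. indicator A x :: 'b::zero_neq_one)"
proof -
  have "simple_fun X (\<lambda>x. x \<in> A)"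
    unfolding simple_fun_def
  proof (intro conjI allI)
    have *: "{x \<in> topspace X. x \<in> A} = A" "{x \<in> topspace X. x \<notin> A} = topspace X - A"
      using zsa.sets_into_space[OF assms] by auto
    show "{x \<in> topspace X. (x \<in> A) = y} \<in> zero_set_algebra X" for y
      using assms by (cases y) (simp_all add: * zsa.compl_sets)
  qed simp
  from simple_fun_compose[OF this, of of_bool] show ?thesis
    by (simp add: indicator_def of_bool_def)
qed

lemma simple_int_cong:
  assumes "\<And>x. x \<in> topspace X \<Longrightarrow> s x = t x"
  shows "simple_int X \<mu> s = simple_int X \<mu> t"
proof -
  have "s ` topspace X = t ` topspace X" "{x \<in> topspace X. s x = y} = {x \<in> topspace X. t x = y}" for y
    using assms by auto
  then show ?thesis
    by (simp add: simple_int_def)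
qed

text \<open>
  The integral of a simple function may be computed along any simple function through which it
  factors. Applied to the pair of two simple functions this replaces the usual passage to common
  refinements of partitions.
\<close>

lemma simple_int_compose:
  fixes \<mu> :: "'a set \<Rightarrow> 'f::real_normed_field"
  assumes add: "Measure_Space.additive (zero_set_algebra X) \<mu>" and p: "simple_fun X p"
  shows "simple_int X \<mu> (\<lambda>x. \<phi> (p x)) = (\<Sum>c\<in>p ` topspace X. \<phi> c * \<mu> {x \<in> topspace X. p x = c})"
proof -
  have fin: "finite (p ` topspace X)"
    using p by (simp add: simple_fun_def)
  have "(\<Sum>c\<in>p ` topspace X. \<phi> c * \<mu> {x \<in> topspace X. p x = c}) =
      (\<Sum>y\<in>\<phi> ` p ` topspace X. \<Sum>c\<in>{c \<in> p ` topspace X. \<phi> c = y}. \<phi> c * \<mu> {x \<in> topspace X. p x = c})"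
    by (rule sum.image_gen[OF fin])
  also have "\<dots> = (\<Sum>y\<in>\<phi> ` p ` topspace X. y * \<mu> {x \<in> topspace X. \<phi> (p x) = y})"
  proof (rule sum.cong[OF refl])
    fix y
    have "(\<Sum>c\<in>{c \<in> p ` topspace X. \<phi> c = y}. \<phi> c * \<mu> {x \<in> topspace X. p x = c}) =
        y * (\<Sum>c\<in>{c \<in> p ` topspace X. \<phi> c = y}. \<mu> {x \<in> topspace X. p x = c})"
      unfolding sum_distrib_left by (rule sum.cong) auto
    also have "(\<Sum>c\<in>{c \<in> p ` topspace X. \<phi> c = y}. \<mu> {x \<in> topspace X. p x = c}) =
        \<mu> (\<Union>c\<in>{c \<in> p ` topspace X. \<phi> c = y}. {x \<in> topspace X. p x = c})"
      using fin p by (intro additive_UN[OF add, symmetric])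
        (auto simp: simple_fun_def disjoint_family_on_def)
    also have "(\<Union>c\<in>{c \<in> p ` topspace X. \<phi> c = y}. {x \<in> topspace X. p x = c}) =
        {x \<in> topspace X. \<phi> (p x) = y}"
      by auto
    finally show "(\<Sum>c\<in>{c \<in> p ` topspace X. \<phi> c = y}. \<phi> c * \<mu> {x \<in> topspace X. p x = c}) =
        y * \<mu> {x \<in> topspace X. \<phi> (p x) = y}" .
  qed
  finally show ?thesis
    by (simp add: simple_int_def image_image)
qed

lemma simple_int_compose2:
  fixes \<mu> :: "'a set \<Rightarrow> 'f::real_normed_field"
  assumes "Measure_Space.additive (zero_set_algebra X) \<mu>" "simple_fun X s" "simple_fun X t"
  shows "simple_int X \<mu> (\<lambda>x. \<phi> (s x) (t x)) =
    (\<Sum>c\<in>(\<lambda>x. (s x, t x)) ` topspace X. \<phi> (fst c) (snd c) * \<mu> {x \<in> topspace X. (s x, t x) = c})"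
  using simple_int_compose[OF assms(1) simple_fun_Pair[OF assms(2,3)], of "\<lambda>c. \<phi> (fst c) (snd c)"]
  by simp

lemma simple_int_add:
  fixes \<mu> :: "'a set \<Rightarrow> 'f::real_normed_field"
  assumes "Measure_Space.additive (zero_set_algebra X) \<mu>" "simple_fun X s" "simple_fun X t"
  shows "simple_int X \<mu> (\<lambda>x. s x + t x) = simple_int X \<mu> s + simple_int X \<mu> t"
  using simple_int_compose2[OF assms, of "\<lambda>a b. a + b"] simple_int_compose2[OF assms, of "\<lambda>a b. a"]
    simple_int_compose2[OF assms, of "\<lambda>a b. b"]
  by (simp add: sum.distrib distrib_right)

lemma simple_int_diff:
  fixes \<mu> :: "'a set \<Rightarrow> 'f::real_normed_field"
  assumes "Measure_Space.additive (zero_set_algebra X) \<mu>" "simple_fun X s" "simple_fun X t"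
  shows "simple_int X \<mu> (\<lambda>x. s x - t x) = simple_int X \<mu> s - simple_int X \<mu> t"
  using simple_int_compose2[OF assms, of "\<lambda>a b. a - b"] simple_int_compose2[OF assms, of "\<lambda>a b. a"]
    simple_int_compose2[OF assms, of "\<lambda>a b. b"]
  by (simp add: sum_subtractf left_diff_distrib)

lemma simple_int_cmult:
  fixes \<mu> :: "'a set \<Rightarrow> 'f::real_normed_field"
  assumes "Measure_Space.additive (zero_set_algebra X) \<mu>" "simple_fun X s"
  shows "simple_int X \<mu> (\<lambda>x. a * s x) = a * simple_int X \<mu> s"
  using simple_int_compose[OF assms, of "\<lambda>b. a * b"]
  by (simp add: simple_int_def sum_distrib_left mult.assoc)

lemma simple_int_indicator:
  fixes \<mu> :: "'a set \<Rightarrow> 'f::real_normed_field"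
  assumes add: "Measure_Space.additive (zero_set_algebra X) \<mu>" and A: "A \<in> zero_set_algebra X"
  shows "simple_int X \<mu> (indicator A) = \<mu> A"
proof -
  have *: "{x \<in> topspace X. indicator A x = (1::'f)} = A"
    using zsa.sets_into_space[OF A] by (auto simp: indicator_def)
  have "(\<Sum>y\<in>indicator A ` topspace X. y * \<mu> {x \<in> topspace X. indicator A x = y}) =
      (\<Sum>y\<in>{0, 1::'f}. y * \<mu> {x \<in> topspace X. indicator A x = y})"
  proof (rule sum.mono_neutral_left)
    show "\<forall>i\<in>{0, 1} - indicator A ` topspace X. i * \<mu> {x \<in> topspace X. indicator A x = i} = 0"
    proof
      fix i :: 'f assume "i \<in> {0, 1} - indicator A ` topspace X"
      then have "{x \<in> topspace X. indicator A x = i} = {}"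
        by auto
      then show "i * \<mu> {x \<in> topspace X. indicator A x = i} = 0"
        by (simp only: additive_empty[OF add] mult_zero_right)
    qed
  qed (auto simp: indicator_def)
  then show ?thesis
    by (simp add: simple_int_def *)
qed

lemma simple_int_mult_decompose:
  fixes \<mu> :: "'a set \<Rightarrow> 'f::real_normed_field"
  assumes add: "Measure_Space.additive (zero_set_algebra X) \<mu>" and u: "simple_fun X u" and s: "simple_fun X s"
  shows "simple_int X \<mu> (\<lambda>x. u x * s x) =
    (\<Sum>y\<in>u ` topspace X. y * simple_int X \<mu> (\<lambda>x. indicator {x \<in> topspace X. u x = y} x * s x))"
proof -
  let ?P = "(\<lambda>x. (u x, s x)) ` topspace X" and ?\<mu> = "\<lambda>c. \<mu> {x \<in> topspace X. (u x, s x) = c}"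
  have fin: "finite (u ` topspace X)"
    using u by (simp add: simple_fun_def)
  have "simple_int X \<mu> (\<lambda>x. indicator {x \<in> topspace X. u x = y} x * s x) =
      (\<Sum>c\<in>?P. (if fst c = y then snd c else 0) * ?\<mu> c)" for y
    using simple_int_compose2[OF add u s, of "\<lambda>a b. if a = y then b else 0"]
    by (subst simple_int_cong[where t = "\<lambda>x. if u x = y then s x else 0"]) (simp_all add: indicator_def)
  then have "(\<Sum>y\<in>u ` topspace X. y * simple_int X \<mu> (\<lambda>x. indicator {x \<in> topspace X. u x = y} x * s x)) =
      (\<Sum>y\<in>u ` topspace X. \<Sum>c\<in>?P. y * ((if fst c = y then snd c else 0) * ?\<mu> c))"
    by (simp add: sum_distrib_left)
  also have "\<dots> = (\<Sum>c\<in>?P. \<Sum>y\<in>u ` topspace X. y * ((if fst c = y then snd c else 0) * ?\<mu> c))"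
    by (rule sum.swap)
  also have "\<dots> = (\<Sum>c\<in>?P. fst c * snd c * ?\<mu> c)"
  proof (rule sum.cong[OF refl])
    fix c assume "c \<in> ?P"
    then have c: "fst c \<in> u ` topspace X"
      by auto
    have "(\<Sum>y\<in>u ` topspace X. y * ((if fst c = y then snd c else 0) * ?\<mu> c)) =
        (\<Sum>y\<in>u ` topspace X. if fst c = y then y * snd c * ?\<mu> c else 0)"
      by (rule sum.cong) (simp_all add: mult.assoc)
    also have "\<dots> = fst c * snd c * ?\<mu> c"
      using fin c by (simp add: sum.delta)
    finally show "(\<Sum>y\<in>u ` topspace X. y * ((if fst c = y then snd c else 0) * ?\<mu> c)) =
        fst c * snd c * ?\<mu> c" .
  qed
  also have "\<dots> = simple_int X \<mu> (\<lambda>x. u x * s x)"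
    using simple_int_compose2[OF add u s, of "\<lambda>a b. a * b"] by simp
  finally show ?thesis ..
qed

context bounded_charge
begin

text \<open>The integral of a real simple function against the variation.\<close>

abbreviation mean :: "('a \<Rightarrow> real) \<Rightarrow> real" where
  "mean \<equiv> simple_int X (variation X m)"

lemma norm_simple_int_le:
  assumes "simple_fun X s"
  shows "norm (simple_int X m s) \<le> mean (\<lambda>x. norm (s x))"
proof -
  have "norm (simple_int X m s) \<le> (\<Sum>y\<in>s ` topspace X. norm (y * m {x \<in> topspace X. s x = y}))"
    unfolding simple_int_def by (rule norm_sum)
  also have "\<dots> \<le> (\<Sum>y\<in>s ` topspace X. norm y * variation X m {x \<in> topspace X. s x = y})"
    using assms unfolding norm_mult
    by (intro sum_mono mult_left_mono norm_le_variation) (simp_all add: simple_fun_def)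
  also have "\<dots> = mean (\<lambda>x. norm (s x))"
    by (rule simple_int_compose[OF variation_additive assms, symmetric])
  finally show ?thesis .
qed

lemma mean_mono:
  assumes "simple_fun X s" "simple_fun X t" "\<And>x. x \<in> topspace X \<Longrightarrow> s x \<le> t x"
  shows "mean s \<le> mean t"
proof -
  have "0 \<le> variation X m {x \<in> topspace X. (s x, t x) = c}" for c
    using simple_fun_Pair[OF assms(1,2)] unfolding simple_fun_def by (intro variation_nonneg) blast
  then show ?thesis
    using simple_int_compose2[OF variation_additive assms(1,2), of "\<lambda>a b. a"]
      simple_int_compose2[OF variation_additive assms(1,2), of "\<lambda>a b. b"] assms(3)
    by (auto intro!: sum_mono mult_right_mono)
qed

lemma mean_nonneg:
  fixes s :: "'a \<Rightarrow> 'f"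
  assumes "simple_fun X s"
  shows "0 \<le> mean (\<lambda>x. norm (s x))"
  by (rule order_trans[OF norm_ge_zero norm_simple_int_le[OF assms]])

lemma mean_chebyshev:
  assumes "simple_fun X s"
  shows "\<delta> * variation X m {x \<in> topspace X. \<delta> < norm (s x)} \<le> mean (\<lambda>x. norm (s x))"
proof -
  let ?A = "{x \<in> topspace X. \<delta> < norm (s x)}"
  have A: "?A \<in> zero_set_algebra X"
    by (rule simple_fun_Collect[OF assms])
  have "\<delta> * variation X m ?A = mean (\<lambda>x. \<delta> * indicator ?A x)"
    by (simp only: simple_int_cmult[OF variation_additive simple_fun_indicator[OF A]]
        simple_int_indicator[OF variation_additive A])
  also have "\<dots> \<le> mean (\<lambda>x. norm (s x))"
    by (intro mean_mono simple_fun_compose[OF simple_fun_indicator[OF A]] simple_fun_compose[OF assms])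
      (simp add: indicator_def)
  finally show ?thesis .
qed

end

section \<open>Determining sequences and the integral\<close>

context bounded_charge
begin

text \<open>
  A determining sequence of a function consists of simple functions that converge to it in measure
  and form a Cauchy sequence in the mean: the kind of sequence that defines the integral.
\<close>

definition determining :: "(nat \<Rightarrow> 'a \<Rightarrow> 'f) \<Rightarrow> ('a \<Rightarrow> 'f) \<Rightarrow> bool" where
  "determining s f \<longleftrightarrow>
     (\<forall>n. simple_fun X (s n)) \<and>
     (\<forall>\<epsilon>>0. (\<lambda>n. outer_variation X m {x \<in> topspace X. norm (s n x - f x) > \<epsilon>}) \<longlonglongrightarrow> 0) \<and>
     (\<forall>\<epsilon>>0. \<exists>N. \<forall>n\<ge>N. \<forall>k\<ge>N. mean (\<lambda>x. norm (s n x - s k x)) < \<epsilon>)"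

lemma has_int_iff_determining:
  "has_int X m f I \<longleftrightarrow> (\<exists>s. determining s f \<and> (\<lambda>n. simple_int X m (s n)) \<longlonglongrightarrow> I)"
  unfolding has_int_def determining_def by blast

lemma determining_simple: "determining s f \<Longrightarrow> simple_fun X (s n)"
  by (simp add: determining_def)

lemma determining_Cauchy:
  assumes "determining s f" "0 < \<epsilon>"
  obtains N where "\<And>n k. N \<le> n \<Longrightarrow> N \<le> k \<Longrightarrow> mean (\<lambda>x. norm (s n x - s k x)) < \<epsilon>"
  using assms unfolding determining_def by meson

lemma tendsto_outer_variation_0:
  assumes "\<And>n. E n \<subseteq> topspace X" "\<And>n. outer_variation X m (E n) \<le> b n" "b \<longlonglongrightarrow> 0"
  shows "(\<lambda>n. outer_variation X m (E n)) \<longlonglongrightarrow> 0"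
  using outer_variation_nonneg[OF assms(1)] assms(2)
  by (intro tendsto_sandwich[OF _ _ tendsto_const assms(3)] always_eventually) auto

text \<open>
  A sequence of simple functions that is Cauchy in the mean and tends to zero in measure tends to
  zero in the mean. Where \<^term>\<open>u n\<close> is small it contributes little because the space has finite
  variation; elsewhere it is close in the mean to a fixed \<^term>\<open>u N\<close>, which is bounded.
\<close>

lemma mean_tendsto_0:
  fixes u :: "nat \<Rightarrow> 'a \<Rightarrow> 'f"
  assumes simple: "\<And>n. simple_fun X (u n)"
    and meas: "\<And>\<delta>. 0 < \<delta> \<Longrightarrow> (\<lambda>n. variation X m {x \<in> topspace X. \<delta> < norm (u n x)}) \<longlonglongrightarrow> 0"
    and Cauchy: "\<And>\<epsilon>. 0 < \<epsilon> \<Longrightarrow> \<exists>N. \<forall>n\<ge>N. mean (\<lambda>x. norm (u n x - u N x)) < \<epsilon>"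
  shows "(\<lambda>n. mean (\<lambda>x. norm (u n x))) \<longlonglongrightarrow> 0"
proof (rule LIMSEQ_I)
  fix e :: real assume e: "0 < e"
  define V where "V = variation X m (topspace X) + 1"
  have V: "0 < V"
    using variation_nonneg[OF zsa.top] by (simp add: V_def add_nonneg_pos)
  define \<delta> where "\<delta> = e / (3 * V)"
  have \<delta>: "0 < \<delta>"
    using e V by (simp add: \<delta>_def)
  obtain N where N: "\<And>n. N \<le> n \<Longrightarrow> mean (\<lambda>x. norm (u n x - u N x)) < e / 3"
    using Cauchy[of "e / 3"] e by auto
  have "finite (u N ` topspace X)"
    using simple[of N] by (simp add: simple_fun_def)
  then have "bounded (u N ` topspace X)"
    by (rule finite_imp_bounded)
  then obtain K where K: "0 < K" "\<And>x. x \<in> topspace X \<Longrightarrow> norm (u N x) \<le> K"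
    unfolding bounded_pos by blast
  obtain N' where N': "\<And>n. N' \<le> n \<Longrightarrow> norm (variation X m {x \<in> topspace X. \<delta> < norm (u n x)}) < e / (3 * K)"
    using LIMSEQ_D[OF meas[OF \<delta>], of "e / (3 * K)"] e K(1) by auto
  show "\<exists>no. \<forall>n\<ge>no. norm (mean (\<lambda>x. norm (u n x)) - 0) < e"
  proof (intro exI[of _ "max N N'"] allI impI)
    fix n assume "max N N' \<le> n"
    then have n: "N \<le> n" "N' \<le> n"
      by auto
    let ?A = "{x \<in> topspace X. \<delta> < norm (u n x)}"
    have A: "?A \<in> zero_set_algebra X"
      by (rule simple_fun_Collect[OF simple])
    have sA: "simple_fun X (indicator ?A :: 'a \<Rightarrow> real)"
      using simple_fun_indicator[OF A] .
    have s1: "simple_fun X (\<lambda>x. norm (u n x - u N x))"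
      by (rule simple_fun_compose2[OF simple simple])
    have s2: "simple_fun X (\<lambda>x. \<delta> * 1 + norm (u n x - u N x))"
      by (intro simple_fun_compose[OF s1])
    have s3: "simple_fun X (\<lambda>x. K * indicator ?A x)"
      by (rule simple_fun_compose[OF sA])
    have "mean (\<lambda>x. norm (u n x)) \<le> mean (\<lambda>x. (\<delta> * 1 + norm (u n x - u N x)) + K * indicator ?A x)"
    proof (rule mean_mono)
      fix x assume x: "x \<in> topspace X"
      show "norm (u n x) \<le> (\<delta> * 1 + norm (u n x - u N x)) + K * indicator ?A x"
      proof (cases "\<delta> < norm (u n x)")
        case True
        have "norm (u n x) \<le> norm (u n x - u N x) + norm (u N x)"
          by (metis add.commute norm_triangle_sub)
        then show ?thesis
          using True x K(2)[OF x] \<delta> by (simp add: indicator_def)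
      next
        case False
        then have "norm (u n x) \<le> \<delta>"
          by simp
        also have "\<dots> \<le> (\<delta> * 1 + norm (u n x - u N x)) + K * indicator ?A x"
          using K(1) by simp
        finally show ?thesis .
      qed
    qed (intro simple_fun_compose2[OF s2 s3] simple_fun_compose[OF simple])+
    also have "\<dots> = \<delta> * variation X m (topspace X) + mean (\<lambda>x. norm (u n x - u N x)) + K * variation X m ?A"
    proof -
      have "mean (\<lambda>x. (\<delta> * 1 + norm (u n x - u N x)) + K * indicator ?A x) =
          mean (\<lambda>x. \<delta> * 1 + norm (u n x - u N x)) + mean (\<lambda>x. K * indicator ?A x)"
        by (rule simple_int_add[OF variation_additive s2 s3])
      moreover have "mean (\<lambda>x. K * indicator ?A x) = K * variation X m ?A"
        by (simp only: simple_int_cmult[OF variation_additive sA] simple_int_indicator[OF variation_additive A])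
      moreover have "mean (\<lambda>x. \<delta> * 1 + norm (u n x - u N x)) =
          mean (\<lambda>x. \<delta> * 1) + mean (\<lambda>x. norm (u n x - u N x))"
        by (rule simple_int_add[OF variation_additive simple_fun_const s1])
      moreover have "mean (\<lambda>x. \<delta> * 1) = mean (\<lambda>x. \<delta> * indicator (topspace X) x)"
        by (rule simple_int_cong) simp
      moreover have "\<dots> = \<delta> * variation X m (topspace X)"
        by (simp only: simple_int_cmult[OF variation_additive simple_fun_indicator[OF zsa.top]]
            simple_int_indicator[OF variation_additive zsa.top])
      ultimately show ?thesis
        by simp
    qed
    also have "\<dots> < e / 3 + e / 3 + e / 3"
    proof (rule add_less_le_mono[OF add_le_less_mono])
      show "\<delta> * variation X m (topspace X) \<le> e / 3"
      proof -
        have "\<delta> * variation X m (topspace X) \<le> \<delta> * V"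
          using \<delta> by (intro mult_left_mono) (auto simp: V_def)
        also have "\<dots> = e / 3"
          using V by (simp add: \<delta>_def)
        finally show ?thesis .
      qed
      show "mean (\<lambda>x. norm (u n x - u N x)) < e / 3"
        by (rule N[OF n(1)])
      show "K * variation X m ?A \<le> e / 3"
      proof -
        have "variation X m ?A \<le> e / (3 * K)"
          using N'[OF n(2)] by simp
        then have "K * variation X m ?A \<le> K * (e / (3 * K))"
          using K(1) by (intro mult_left_mono) auto
        then show ?thesis
          using K(1) by simp
      qed
    qed
    finally have "mean (\<lambda>x. norm (u n x)) < e"
      by simp
    then show "norm (mean (\<lambda>x. norm (u n x)) - 0) < e"
      using mean_nonneg[OF simple[of n]] by simp
  qed
qed

lemma determining_diff_tendsto_0:
  assumes s: "determining s f" and t: "determining t f"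
  shows "(\<lambda>n. mean (\<lambda>x. norm (s n x - t n x))) \<longlonglongrightarrow> 0"
proof (rule mean_tendsto_0)
  note ss = determining_simple[OF s] and st = determining_simple[OF t]
  show sst: "simple_fun X (\<lambda>x. s n x - t n x)" for n
    by (rule simple_fun_compose2[OF ss st])
  fix \<delta> :: real assume \<delta>: "0 < \<delta>"
  let ?S = "\<lambda>n. {x \<in> topspace X. \<delta> / 2 < norm (s n x - f x)}"
  let ?T = "\<lambda>n. {x \<in> topspace X. \<delta> / 2 < norm (t n x - f x)}"
  let ?U = "\<lambda>n. {x \<in> topspace X. \<delta> < norm (s n x - t n x)}"
  have "(\<lambda>n. outer_variation X m (?U n)) \<longlonglongrightarrow> 0"
  proof (rule tendsto_outer_variation_0)
    fix n
    have "?U n \<subseteq> ?S n \<union> ?T n"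
    proof
      fix x assume x: "x \<in> ?U n"
      have "norm (s n x - t n x) \<le> norm (s n x - f x) + norm (t n x - f x)"
        using norm_triangle_ineq4[of "s n x - f x" "t n x - f x"] by simp
      then show "x \<in> ?S n \<union> ?T n"
        using x by auto
    qed
    then have "outer_variation X m (?U n) \<le> outer_variation X m (?S n \<union> ?T n)"
      by (intro outer_variation_mono) auto
    also have "\<dots> \<le> outer_variation X m (?S n) + outer_variation X m (?T n)"
      by (intro outer_variation_Un_le) auto
    finally show "outer_variation X m (?U n) \<le> outer_variation X m (?S n) + outer_variation X m (?T n)" .
  next
    have "(\<lambda>n. outer_variation X m (?S n)) \<longlonglongrightarrow> 0" "(\<lambda>n. outer_variation X m (?T n)) \<longlonglongrightarrow> 0"
      using s t half_gt_zero[OF \<delta>] unfolding determining_def by blast+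
    from tendsto_add[OF this]
    show "(\<lambda>n. outer_variation X m (?S n) + outer_variation X m (?T n)) \<longlonglongrightarrow> 0"
      by simp
  qed auto
  moreover have "outer_variation X m (?U n) = variation X m (?U n)" for n
    by (rule outer_variation_eq[OF simple_fun_Collect[OF sst]])
  ultimately show "(\<lambda>n. variation X m (?U n)) \<longlonglongrightarrow> 0"
    by simp
next
  note ss = determining_simple[OF s] and st = determining_simple[OF t]
  fix \<epsilon> :: real assume \<epsilon>: "0 < \<epsilon>"
  obtain N1 where N1: "\<And>n k. N1 \<le> n \<Longrightarrow> N1 \<le> k \<Longrightarrow> mean (\<lambda>x. norm (s n x - s k x)) < \<epsilon> / 2"
    using determining_Cauchy[OF s half_gt_zero[OF \<epsilon>]] by blast
  obtain N2 where N2: "\<And>n k. N2 \<le> n \<Longrightarrow> N2 \<le> k \<Longrightarrow> mean (\<lambda>x. norm (t n x - t k x)) < \<epsilon> / 2"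
    using determining_Cauchy[OF t half_gt_zero[OF \<epsilon>]] by blast
  show "\<exists>N. \<forall>n\<ge>N. mean (\<lambda>x. norm (s n x - t n x - (s N x - t N x))) < \<epsilon>"
  proof (intro exI[of _ "max N1 N2"] allI impI)
    fix n assume n: "max N1 N2 \<le> n"
    let ?N = "max N1 N2"
    have a: "simple_fun X (\<lambda>x. norm (s n x - s ?N x))" "simple_fun X (\<lambda>x. norm (t n x - t ?N x))"
      by (rule simple_fun_compose2[OF ss ss] simple_fun_compose2[OF st st])+
    have b: "simple_fun X (\<lambda>x. s n x - t n x)" for n
      by (rule simple_fun_compose2[OF ss st])
    have "mean (\<lambda>x. norm (s n x - t n x - (s ?N x - t ?N x)))
        \<le> mean (\<lambda>x. norm (s n x - s ?N x) + norm (t n x - t ?N x))"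
    proof (rule mean_mono)
      fix x
      have "s n x - t n x - (s ?N x - t ?N x) = (s n x - s ?N x) - (t n x - t ?N x)"
        by (simp add: algebra_simps)
      then show "norm (s n x - t n x - (s ?N x - t ?N x)) \<le> norm (s n x - s ?N x) + norm (t n x - t ?N x)"
        using norm_triangle_ineq4 by metis
    qed (intro simple_fun_compose2[OF b b] simple_fun_compose2[OF a])+
    also have "\<dots> = mean (\<lambda>x. norm (s n x - s ?N x)) + mean (\<lambda>x. norm (t n x - t ?N x))"
      by (rule simple_int_add[OF variation_additive a])
    also have "\<dots> < \<epsilon>"
      using N1[of n ?N] N2[of n ?N] n by simp
    finally show "mean (\<lambda>x. norm (s n x - t n x - (s ?N x - t ?N x))) < \<epsilon>" .
  qed
qed

lemma determining_simple_int_diff: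
  assumes s: "determining s f" and t: "determining t f"
  shows "(\<lambda>n. simple_int X m (s n) - simple_int X m (t n)) \<longlonglongrightarrow> 0"
proof (rule Lim_null_comparison[OF always_eventually determining_diff_tendsto_0[OF s t]], rule allI)
  note ss = determining_simple[OF s] and st = determining_simple[OF t]
  fix n
  have "norm (simple_int X m (\<lambda>x. s n x - t n x)) \<le> mean (\<lambda>x. norm (s n x - t n x))"
    by (rule norm_simple_int_le[OF simple_fun_compose2[OF ss st]])
  then show "norm (simple_int X m (s n) - simple_int X m (t n)) \<le> mean (\<lambda>x. norm (s n x - t n x))"
    by (simp only: simple_int_diff[OF additive ss st])
qed

lemma has_int_unique:
  assumes "has_int X m f I" "has_int X m f J"
  shows "I = J"
proof -
  obtain s where s: "determining s f" "(\<lambda>n. simple_int X m (s n)) \<longlonglongrightarrow> I"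
    using assms(1) has_int_iff_determining by blast
  obtain t where t: "determining t f" "(\<lambda>n. simple_int X m (t n)) \<longlonglongrightarrow> J"
    using assms(2) has_int_iff_determining by blast
  have "(\<lambda>n. simple_int X m (s n) - simple_int X m (t n)) \<longlonglongrightarrow> 0"
    by (rule determining_simple_int_diff[OF s(1) t(1)])
  moreover have "(\<lambda>n. simple_int X m (s n) - simple_int X m (t n)) \<longlonglongrightarrow> I - J"
    by (intro tendsto_diff s t)
  ultimately show ?thesis
    using LIMSEQ_unique by fastforce
qed

lemma int_over_eq: "has_int X m f I \<Longrightarrow> int_over X m f = I"
  unfolding int_over_def by (rule the_equality) (auto intro: has_int_unique)

lemma int_exists_iff_determining: "int_exists X m f \<longleftrightarrow> (\<exists>s. determining s f)"
proof
  assume "int_exists X m f"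
  then show "\<exists>s. determining s f"
    by (auto simp: int_exists_def has_int_iff_determining)
next
  assume "\<exists>s. determining s f"
  then obtain s where s: "determining s f" ..
  note ss = determining_simple[OF s]
  have "Cauchy (\<lambda>n. simple_int X m (s n))"
  proof (rule CauchyI)
    fix e :: real assume "0 < e"
    then obtain N where N: "\<And>n k. N \<le> n \<Longrightarrow> N \<le> k \<Longrightarrow> mean (\<lambda>x. norm (s n x - s k x)) < e"
      using determining_Cauchy[OF s] by blast
    have "norm (simple_int X m (s n) - simple_int X m (s k)) < e" if "N \<le> n" "N \<le> k" for n k
    proof -
      have "norm (simple_int X m (\<lambda>x. s n x - s k x)) \<le> mean (\<lambda>x. norm (s n x - s k x))"
        by (rule norm_simple_int_le[OF simple_fun_compose2[OF ss ss]])
      then show ?thesis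
        using N[OF that] by (simp only: simple_int_diff[OF additive ss ss])
    qed
    then show "\<exists>N. \<forall>n\<ge>N. \<forall>k\<ge>N. norm (simple_int X m (s n) - simple_int X m (s k)) < e"
      by blast
  qed
  then have "convergent (\<lambda>n. simple_int X m (s n))"
    by (rule Cauchy_convergent)
  then show "int_exists X m f"
    using s by (auto simp: int_exists_def has_int_iff_determining convergent_def)
qed

lemma has_int_int_over: "int_exists X m f \<Longrightarrow> has_int X m f (int_over X m f)"
  by (metis int_exists_def int_over_eq)

lemma determining_tendsto_int_over:
  assumes "determining s f"
  shows "(\<lambda>n. simple_int X m (s n)) \<longlonglongrightarrow> int_over X m f"
proof -
  obtain t where t: "determining t f" "(\<lambda>n. simple_int X m (t n)) \<longlonglongrightarrow> int_over X m f"
    using assms has_int_int_over int_exists_iff_determining has_int_iff_determining by blast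
  have "(\<lambda>n. simple_int X m (s n) - simple_int X m (t n)) \<longlonglongrightarrow> 0"
    by (rule determining_simple_int_diff[OF assms t(1)])
  from tendsto_add[OF this t(2)] show ?thesis
    by simp
qed

text \<open>Functions that agree almost everywhere have the same determining sequences.\<close>

lemma determining_cong_ae:
  assumes s: "determining s f" and ae: "outer_variation X m {x \<in> topspace X. f x \<noteq> g x} = 0"
  shows "determining s g"
  unfolding determining_def
proof (intro conjI allI impI)
  fix \<epsilon> :: real assume \<epsilon>: "0 < \<epsilon>"
  let ?F = "\<lambda>n. {x \<in> topspace X. \<epsilon> < norm (s n x - f x)}"
  let ?G = "\<lambda>n. {x \<in> topspace X. \<epsilon> < norm (s n x - g x)}"
  show "(\<lambda>n. outer_variation X m (?G n)) \<longlonglongrightarrow> 0"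
  proof (rule tendsto_outer_variation_0)
    fix n
    have "outer_variation X m (?G n) \<le> outer_variation X m (?F n \<union> {x \<in> topspace X. f x \<noteq> g x})"
      by (intro outer_variation_mono) auto
    also have "\<dots> \<le> outer_variation X m (?F n) + outer_variation X m {x \<in> topspace X. f x \<noteq> g x}"
      by (intro outer_variation_Un_le) auto
    finally show "outer_variation X m (?G n) \<le> outer_variation X m (?F n)"
      using ae by simp
  next
    show "(\<lambda>n. outer_variation X m (?F n)) \<longlonglongrightarrow> 0"
      using s \<epsilon> by (simp add: determining_def)
  qed auto
qed (use s in \<open>simp_all add: determining_def\<close>)

lemma determining_mean_bounded:
  assumes s: "determining s f"
  obtains C where "0 < C" "\<And>n. mean (\<lambda>x. norm (s n x)) \<le> C"
proof -
  note ss = determining_simple[OF s]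
  obtain N where N: "\<And>n k. N \<le> n \<Longrightarrow> N \<le> k \<Longrightarrow> mean (\<lambda>x. norm (s n x - s k x)) < 1"
    using determining_Cauchy[OF s zero_less_one] by blast
  define C where "C = Max (insert 1 ((\<lambda>n. mean (\<lambda>x. norm (s n x))) ` {..N})) + 1"
  have C: "b + 1 \<le> C" if "b \<in> insert 1 ((\<lambda>n. mean (\<lambda>x. norm (s n x))) ` {..N})" for b
    using that unfolding C_def by (intro add_right_mono Max_ge) auto
  have "mean (\<lambda>x. norm (s n x)) \<le> C" for n
  proof (cases "n \<le> N")
    case True
    then show ?thesis
      using C[of "mean (\<lambda>x. norm (s n x))"] by fastforce
  next
    case False
    have a: "simple_fun X (\<lambda>x. norm (s n x - s N x))" "simple_fun X (\<lambda>x. norm (s N x))"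
      by (rule simple_fun_compose2[OF ss ss] simple_fun_compose[OF ss])+
    have "mean (\<lambda>x. norm (s n x)) \<le> mean (\<lambda>x. norm (s n x - s N x) + norm (s N x))"
    proof (rule mean_mono)
      show "norm (s n x) \<le> norm (s n x - s N x) + norm (s N x)" for x
        by (metis add.commute norm_triangle_sub)
    qed (intro simple_fun_compose2[OF a] simple_fun_compose[OF ss])+
    also have "\<dots> = mean (\<lambda>x. norm (s n x - s N x)) + mean (\<lambda>x. norm (s N x))"
      by (rule simple_int_add[OF variation_additive a])
    also have "\<dots> \<le> 1 + mean (\<lambda>x. norm (s N x))"
      using N[of n N] False by simp
    also have "\<dots> \<le> C"
      using C[of "mean (\<lambda>x. norm (s N x))"] by simp
    finally show ?thesis .
  qed
  moreover have "0 < C"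
    using C[of 1] by simp
  ultimately show ?thesis
    using that by blast
qed

lemma mean_norm_mult_le:
  fixes u s :: "'a \<Rightarrow> 'f"
  assumes "simple_fun X u" "simple_fun X s" "0 \<le> K" "\<And>x. x \<in> topspace X \<Longrightarrow> norm (u x) \<le> K"
  shows "mean (\<lambda>x. norm (u x * s x)) \<le> K * mean (\<lambda>x. norm (s x))"
proof -
  have "mean (\<lambda>x. norm (u x * s x)) \<le> mean (\<lambda>x. K * norm (s x))"
  proof (intro mean_mono simple_fun_compose2[OF assms(1,2)] simple_fun_compose[OF assms(2)])
    show "norm (u x * s x) \<le> K * norm (s x)" if "x \<in> topspace X" for x
      using mult_right_mono[OF assms(4)[OF that] norm_ge_zero[of "s x"]] by (simp only: norm_mult)
  qed
  also have "\<dots> = K * mean (\<lambda>x. norm (s x))"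
    by (rule simple_int_cmult[OF variation_additive simple_fun_compose[OF assms(2)]])
  finally show ?thesis .
qed

text \<open>
  In the convergence in measure the factor \<^term>\<open>f\<close> may be unbounded; the error
  \<^term>\<open>(u n x - w x) * s n x\<close> is controlled by the Chebyshev inequality and the boundedness of the
  means of \<^term>\<open>s n\<close>.
\<close>

lemma determining_mult:
  assumes s: "determining s f"
    and u: "\<And>n. simple_fun X (u n)" and unif: "uniform_limit (topspace X) u w sequentially"
    and K: "0 < K" "\<And>n x. x \<in> topspace X \<Longrightarrow> norm (u n x) \<le> K"
  shows "determining (\<lambda>n x. u n x * s n x) (\<lambda>x. w x * f x)"
  unfolding determining_def
proof (intro conjI allI impI)
  note ss = determining_simple[OF s]
  show "simple_fun X (\<lambda>x. u n x * s n x)" for n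
    by (rule simple_fun_compose2[OF u ss])
  obtain C where C: "0 < C" "\<And>n. mean (\<lambda>x. norm (s n x)) \<le> C"
    using determining_mean_bounded[OF s] by blast
  have near: "\<exists>N. \<forall>n\<ge>N. \<forall>x\<in>topspace X. norm (u n x - w x) < \<eta>" if "0 < \<eta>" for \<eta>
    using unif that unfolding uniform_limit_sequentially_iff dist_norm by blast
  fix \<epsilon> :: real assume \<epsilon>: "0 < \<epsilon>"
  show "(\<lambda>n. outer_variation X m {x \<in> topspace X. \<epsilon> < norm (u n x * s n x - w x * f x)}) \<longlonglongrightarrow> 0"
  proof (rule LIMSEQ_I)
    fix e :: real assume e: "0 < e"
    define \<eta> where "\<eta> = min 1 (\<epsilon> * e / (4 * C))"
    have \<eta>: "0 < \<eta>" "\<eta> \<le> 1" "\<eta> \<le> \<epsilon> * e / (4 * C)"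
      using \<epsilon> e C by (auto simp: \<eta>_def)
    obtain N1 where N1: "\<And>n x. N1 \<le> n \<Longrightarrow> x \<in> topspace X \<Longrightarrow> norm (u n x - w x) < \<eta>"
      using near[OF \<eta>(1)] by blast
    let ?F = "\<lambda>n. {x \<in> topspace X. \<epsilon> / (2 * (K + 1)) < norm (s n x - f x)}"
    have "(\<lambda>n. outer_variation X m (?F n)) \<longlonglongrightarrow> 0"
      using s \<epsilon> K(1) by (simp add: determining_def)
    from LIMSEQ_D[OF this half_gt_zero[OF e]] obtain N2
      where N2: "\<And>n. N2 \<le> n \<Longrightarrow> norm (outer_variation X m (?F n)) < e / 2"
      by auto
    show "\<exists>no. \<forall>n\<ge>no. norm (outer_variation X m {x \<in> topspace X. \<epsilon> < norm (u n x * s n x - w x * f x)} - 0) < e"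
    proof (intro exI[of _ "max N1 N2"] allI impI)
      fix n assume "max N1 N2 \<le> n"
      then have n: "N1 \<le> n" "N2 \<le> n"
        by auto
      let ?U = "{x \<in> topspace X. \<epsilon> < norm (u n x * s n x - w x * f x)}"
      let ?S = "{x \<in> topspace X. \<epsilon> / (2 * \<eta>) < norm (s n x)}"
      have S: "?S \<in> zero_set_algebra X"
        by (rule simple_fun_Collect[OF ss])
      have sub: "?U \<subseteq> ?S \<union> ?F n"
      proof
        fix x assume x: "x \<in> ?U"
        have close: "norm (u n x - w x) < \<eta>"
          using N1[OF n(1)] x by blast
        have "norm (w x) \<le> norm (u n x) + norm (u n x - w x)"
          by (metis norm_minus_commute norm_triangle_sub)
        then have w: "norm (w x) \<le> K + 1"
          using close \<eta>(2) K(2)[of x n] x by auto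
        show "x \<in> ?S \<union> ?F n"
        proof (rule ccontr)
          assume "x \<notin> ?S \<union> ?F n"
          then have a: "norm (s n x) \<le> \<epsilon> / (2 * \<eta>)" and b: "norm (s n x - f x) \<le> \<epsilon> / (2 * (K + 1))"
            using x by auto
          have "u n x * s n x - w x * f x = (u n x - w x) * s n x + w x * (s n x - f x)"
            by (simp add: algebra_simps)
          then have "norm (u n x * s n x - w x * f x)
              \<le> norm (u n x - w x) * norm (s n x) + norm (w x) * norm (s n x - f x)"
            by (metis norm_mult norm_triangle_ineq)
          also have "\<dots> \<le> \<eta> * (\<epsilon> / (2 * \<eta>)) + (K + 1) * (\<epsilon> / (2 * (K + 1)))"
            using a b w close \<eta>(1) K(1) by (intro add_mono mult_mono) auto
          also have "\<dots> = \<epsilon> / 2 + \<epsilon> / 2"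
            using \<eta>(1) K(1) by (intro arg_cong2[where f = "(+)"]) (simp_all add: divide_simps)
          also have "\<dots> = \<epsilon>"
            by simp
          finally show False
            using x by simp
        qed
      qed
      have "\<epsilon> / (2 * \<eta>) * variation X m ?S \<le> C"
        using mean_chebyshev[OF ss] C(2) order_trans by blast
      then have "variation X m ?S \<le> C * (2 * \<eta>) / \<epsilon>"
        using \<epsilon> \<eta>(1) by (simp add: field_simps)
      also have "\<dots> \<le> C * (2 * (\<epsilon> * e / (4 * C))) / \<epsilon>"
        using \<epsilon> \<eta>(3) C(1) by (intro divide_right_mono mult_left_mono) auto
      also have "\<dots> = e / 2"
        using \<epsilon> C(1) by simp
      finally have vS: "variation X m ?S \<le> e / 2" .
      have "outer_variation X m ?U \<le> outer_variation X m (?S \<union> ?F n)"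
        using sub by (intro outer_variation_mono) auto
      also have "\<dots> \<le> outer_variation X m ?S + outer_variation X m (?F n)"
        by (intro outer_variation_Un_le) auto
      also have "\<dots> < e"
        using N2[OF n(2)] vS by (simp add: outer_variation_eq[OF S])
      finally show "norm (outer_variation X m ?U - 0) < e"
        using outer_variation_nonneg[of ?U] by simp
    qed
  qed
next
  note ss = determining_simple[OF s]
  obtain C where C: "0 < C" "\<And>n. mean (\<lambda>x. norm (s n x)) \<le> C"
    using determining_mean_bounded[OF s] by blast
  fix \<epsilon> :: real assume \<epsilon>: "0 < \<epsilon>"
  define \<eta> where "\<eta> = \<epsilon> / (4 * C)"
  have \<eta>: "0 < \<eta>"
    using \<epsilon> C by (simp add: \<eta>_def)
  obtain N1 where N1: "\<And>n x. N1 \<le> n \<Longrightarrow> x \<in> topspace X \<Longrightarrow> norm (u n x - w x) < \<eta>"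
    using unif \<eta> unfolding uniform_limit_sequentially_iff dist_norm by blast
  obtain N2 where N2: "\<And>n k. N2 \<le> n \<Longrightarrow> N2 \<le> k \<Longrightarrow> mean (\<lambda>x. norm (s n x - s k x)) < \<epsilon> / (2 * K)"
    using determining_Cauchy[OF s, of "\<epsilon> / (2 * K)"] \<epsilon> K(1) by auto
  show "\<exists>N. \<forall>n\<ge>N. \<forall>k\<ge>N. mean (\<lambda>x. norm (u n x * s n x - u k x * s k x)) < \<epsilon>"
  proof (intro exI[of _ "max N1 N2"] allI impI)
    fix n k assume "max N1 N2 \<le> n" "max N1 N2 \<le> k"
    then have nk: "N1 \<le> n" "N2 \<le> n" "N1 \<le> k" "N2 \<le> k"
      by auto
    have d: "simple_fun X (\<lambda>x. s n x - s k x)" "simple_fun X (\<lambda>x. u n x - u k x)"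
      by (rule simple_fun_compose2[OF ss ss] simple_fun_compose2[OF u u])+
    have p: "simple_fun X (\<lambda>x. u n x * s n x)" "simple_fun X (\<lambda>x. u k x * s k x)"
      by (rule simple_fun_compose2[OF u ss])+
    have a: "simple_fun X (\<lambda>x. norm (u n x * (s n x - s k x)))"
        "simple_fun X (\<lambda>x. norm ((u n x - u k x) * s k x))"
      by (intro simple_fun_compose2[OF u d(1)] simple_fun_compose2[OF d(2) ss])+
    have "mean (\<lambda>x. norm (u n x * s n x - u k x * s k x))
        \<le> mean (\<lambda>x. norm (u n x * (s n x - s k x)) + norm ((u n x - u k x) * s k x))"
    proof (rule mean_mono)
      fix x
      have "u n x * s n x - u k x * s k x = u n x * (s n x - s k x) + (u n x - u k x) * s k x"
        by (simp add: algebra_simps)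
      then show "norm (u n x * s n x - u k x * s k x)
          \<le> norm (u n x * (s n x - s k x)) + norm ((u n x - u k x) * s k x)"
        by (metis norm_triangle_ineq)
    qed (intro simple_fun_compose2[OF p] simple_fun_compose2[OF a])+
    also have "\<dots> = mean (\<lambda>x. norm (u n x * (s n x - s k x))) + mean (\<lambda>x. norm ((u n x - u k x) * s k x))"
      by (rule simple_int_add[OF variation_additive a])
    also have "\<dots> \<le> K * mean (\<lambda>x. norm (s n x - s k x)) + (2 * \<eta>) * mean (\<lambda>x. norm (s k x))"
    proof (intro add_mono mean_norm_mult_le u ss d)
      fix x assume x: "x \<in> topspace X"
      have "norm (u n x - u k x) \<le> norm (u n x - w x) + norm (u k x - w x)"
        by (metis dist_norm dist_triangle2)
      also have "\<dots> \<le> 2 * \<eta>"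
        using N1[OF nk(1) x] N1[OF nk(3) x] by simp
      finally show "norm (u n x - u k x) \<le> 2 * \<eta>" .
    qed (use K \<eta> in auto)
    also have "\<dots> < K * (\<epsilon> / (2 * K)) + (2 * \<eta>) * C"
      using N2[OF nk(2,4)] K(1) C(2)[of k] \<eta>
      by (intro add_less_le_mono mult_strict_left_mono mult_left_mono) auto
    also have "\<dots> = \<epsilon>"
      using K(1) C(1) by (simp add: \<eta>_def)
    finally show "mean (\<lambda>x. norm (u n x * s n x - u k x * s k x)) < \<epsilon>" .
  qed
qed

lemma determining_one: "determining (\<lambda>n x. 1) (\<lambda>x. 1)"
proof -
  have "mean (\<lambda>x. norm (1 - 1 :: 'f)) = 0"
    using simple_int_cmult[OF variation_additive simple_fun_const, of 0 0] by simp
  then show ?thesis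
    by (simp add: determining_def simple_fun_const outer_variation_empty)
qed

lemma determining_uniform_limit:
  assumes "\<And>n. simple_fun X (u n)" "uniform_limit (topspace X) u w sequentially"
    and "0 < K" "\<And>n x. x \<in> topspace X \<Longrightarrow> norm (u n x) \<le> K"
  shows "determining u w"
  using determining_mult[OF determining_one assms(1-4)] by simp

lemma int_cong_ae:
  assumes "int_exists X m f" "outer_variation X m {x \<in> topspace X. f x \<noteq> g x} = 0"
  shows "int_exists X m g" "int_over X m g = int_over X m f"
proof -
  obtain s where s: "determining s f"
    using assms(1) int_exists_iff_determining by blast
  then have g: "determining s g"
    using assms(2) by (rule determining_cong_ae)
  then show "int_exists X m g"
    using int_exists_iff_determining by blast
  show "int_over X m g = int_over X m f"
    using determining_tendsto_int_over[OF g] determining_tendsto_int_over[OF s] by (rule LIMSEQ_unique)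
qed

lemma int_cong:
  assumes "int_exists X m f" "\<And>x. x \<in> topspace X \<Longrightarrow> f x = g x"
  shows "int_exists X m g" "int_over X m g = int_over X m f"
proof -
  have empty: "{x \<in> topspace X. f x \<noteq> g x} = {}"
    using assms(2) by auto
  have "outer_variation X m {x \<in> topspace X. f x \<noteq> g x} = 0"
    unfolding empty by (rule outer_variation_empty)
  from int_cong_ae[OF assms(1) this]
  show "int_exists X m g" "int_over X m g = int_over X m f" .
qed

end

section \<open>Bounded continuous functions as uniform limits of simple functions\<close>

lemma cball_vimage_in_algebra:
  fixes w :: "'a \<Rightarrow> 'b::real_normed_vector"
  assumes w: "continuous_map X euclidean w" "bounded (w ` topspace X)"
  shows "{x \<in> topspace X. norm (w x - c) \<le> e} \<in> zero_set_algebra X"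
proof -
  obtain b where b: "\<And>x. x \<in> topspace X \<Longrightarrow> norm (w x) \<le> b"
    using w(2) by (auto simp: bounded_iff)
  have "continuous_map X euclidean (\<lambda>x. max 0 (norm (w x - c) - e))"
    using w(1) by (intro continuous_map_real_max continuous_map_diff continuous_map_norm) auto
  moreover have "bounded ((\<lambda>x. max 0 (norm (w x - c) - e)) ` topspace X)"
    unfolding bounded_iff
  proof (intro exI[of _ "b + norm c + \<bar>e\<bar>"] ballI, elim imageE)
    fix y x assume x: "x \<in> topspace X" and y: "y = max 0 (norm (w x - c) - e)"
    have 1: "norm (w x - c) \<le> b + norm c"
      using norm_triangle_ineq4[of "w x" c] b[OF x] by linarith
    then have 2: "0 \<le> b + norm c"
      using norm_ge_zero[of "w x - c"] by linarith
    show "norm y \<le> b + norm c + \<bar>e\<bar>"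
      using 1 2 unfolding y by (auto simp: max_def)
  qed
  ultimately have "{x \<in> topspace X. max 0 (norm (w x - c) - e) = 0} \<in> zero_set_algebra X"
    using zero_setsI zero_sets_subset_algebra by blast
  moreover have "{x \<in> topspace X. max 0 (norm (w x - c) - e) = 0} = {x \<in> topspace X. norm (w x - c) \<le> e}"
    by (auto simp: max_def split: if_splits)
  ultimately show ?thesis
    by simp
qed

text \<open>
  The bounded range is covered by finitely many balls of radius \<^term>\<open>e\<close>; the approximating function
  sends a point to the centre of the first closed ball that contains its value.
\<close>

lemma bounded_continuous_near_simple:
  fixes w :: "'a \<Rightarrow> 'b::euclidean_space"
  assumes w: "continuous_map X euclidean w" "bounded (w ` topspace X)" and e: "0 < e"
  shows "\<exists>u. simple_fun X u \<and> (\<forall>x\<in>topspace X. norm (u x - w x) \<le> e)"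
proof -
  have "compact (closure (w ` topspace X))"
    using w(2) by simp
  then obtain k where k: "finite k" "closure (w ` topspace X) \<subseteq> (\<Union>c\<in>k. ball c e)"
    using e unfolding compact_eq_totally_bounded by (elim conjE allE impE exE) auto
  obtain c :: "nat \<Rightarrow> 'b" and n where c: "k = c ` {i. i < n}"
    using finite_imp_nat_seg_image_inj_on[OF k(1)] by (elim exE conjE) auto
  define A where "A i = {x \<in> topspace X. norm (w x - c i) \<le> e}" for i
  have A: "A i \<in> zero_set_algebra X" for i
    unfolding A_def by (rule cball_vimage_in_algebra[OF w])
  have cover: "\<exists>i<n. x \<in> A i" if x: "x \<in> topspace X" for x
  proof -
    have "w x \<in> closure (w ` topspace X)"
      using subsetD[OF closure_subset imageI[OF x]] .
    then have "w x \<in> (\<Union>c\<in>k. ball c e)"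
      by (rule subsetD[OF k(2)])
    then obtain a where a: "a \<in> k" "w x \<in> ball a e"
      by (rule UN_E)
    then obtain i where i: "i < n" "a = c i"
      unfolding c by (elim imageE) simp
    have "norm (w x - c i) \<le> e"
      using a(2) unfolding i(2) mem_ball dist_norm by (simp add: norm_minus_commute)
    then show ?thesis
      using x i(1) unfolding A_def by blast
  qed
  define p where "p x = (LEAST i. x \<in> A i)" for x
  have p: "x \<in> A (p x)" "p x < n" if x: "x \<in> topspace X" for x
  proof -
    obtain i where i: "i < n" "x \<in> A i"
      using cover[OF x] by blast
    show "x \<in> A (p x)"
      unfolding p_def using i(2) by (rule LeastI)
    have "p x \<le> i"
      unfolding p_def using i(2) by (rule Least_le)
    then show "p x < n"
      using i(1) by simp
  qed
  have "simple_fun X p"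
    unfolding simple_fun_def
  proof (intro conjI allI)
    show "finite (p ` topspace X)"
      by (rule finite_subset[of _ "{..<n}"]) (use p(2) in auto)
    fix i
    have "{x \<in> topspace X. p x = i} = A i - (\<Union>j\<in>{..<i}. A j)"
    proof (intro equalityI subsetI)
      fix x assume "x \<in> {x \<in> topspace X. p x = i}"
      then have x: "x \<in> topspace X" "p x = i"
        by auto
      then have "x \<notin> A j" if "j < i" for j
        using not_less_Least[of j "\<lambda>i. x \<in> A i"] that unfolding p_def by simp
      then show "x \<in> A i - (\<Union>j\<in>{..<i}. A j)"
        using p(1)[OF x(1)] x(2) by auto
    next
      fix x assume x: "x \<in> A i - (\<Union>j\<in>{..<i}. A j)"
      have "p x = i"
        unfolding p_def
      proof (rule Least_equality)
        show "x \<in> A i"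
          using x by simp
        show "i \<le> j" if "x \<in> A j" for j
          using x that by (meson DiffD2 UN_I lessThan_iff not_le)
      qed
      then show "x \<in> {x \<in> topspace X. p x = i}"
        using x by (auto simp: A_def)
    qed
    also have "\<dots> \<in> zero_set_algebra X"
      using A by (intro zsa.Diff zsa.finite_UN) auto
    finally show "{x \<in> topspace X. p x = i} \<in> zero_set_algebra X" .
  qed
  then have "simple_fun X (\<lambda>x. c (p x))"
    by (rule simple_fun_compose)
  moreover have "norm (c (p x) - w x) \<le> e" if "x \<in> topspace X" for x
    using p(1)[OF that] by (simp add: A_def norm_minus_commute)
  ultimately show ?thesis
    by blast
qed

lemma bounded_continuous_uniform_limit:
  fixes w :: "'a \<Rightarrow> 'b::euclidean_space"
  assumes w: "continuous_map X euclidean w" "bounded (w ` topspace X)"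
  obtains u :: "nat \<Rightarrow> 'a \<Rightarrow> 'b" and K where "\<And>n. simple_fun X (u n)"
    "uniform_limit (topspace X) u w sequentially"
    "0 < K" "\<And>n x. x \<in> topspace X \<Longrightarrow> norm (u n x) \<le> K"
proof -
  have "\<exists>u. simple_fun X u \<and> (\<forall>x\<in>topspace X. norm (u x - w x) \<le> inverse (Suc n))" for n
    by (rule bounded_continuous_near_simple[OF w]) simp
  then obtain u where u: "\<And>n. simple_fun X (u n)"
      "\<And>n x. x \<in> topspace X \<Longrightarrow> norm (u n x - w x) \<le> inverse (Suc n)"
    by metis
  have "uniform_limit (topspace X) u w sequentially"
    unfolding uniform_limit_sequentially_iff
  proof (intro allI impI)
    fix e :: real assume "0 < e"
    then obtain N where N: "inverse (Suc N) < e"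
      using reals_Archimedean by blast
    show "\<exists>N. \<forall>n\<ge>N. \<forall>x\<in>topspace X. dist (u n x) (w x) < e"
    proof (intro exI[of _ N] allI impI ballI)
      fix n x assume n: "N \<le> n" and x: "x \<in> topspace X"
      have "inverse (real (Suc n)) \<le> inverse (real (Suc N))"
        using n by (intro le_imp_inverse_le) auto
      then show "dist (u n x) (w x) < e"
        using u(2)[OF x, of n] N unfolding dist_norm by linarith
    qed
  qed
  moreover obtain b where b: "0 < b" "\<And>x. x \<in> topspace X \<Longrightarrow> norm (w x) \<le> b"
    using w(2) unfolding bounded_pos by blast
  moreover have "norm (u n x) \<le> b + 1" if x: "x \<in> topspace X" for n x
  proof -
    have "inverse (real (Suc n)) \<le> 1"
      by (simp add: divide_simps)
    then show ?thesis
      using u(2)[OF x, of n] b(2)[OF x] norm_triangle_sub[of "u n x" "w x"] by linarith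
  qed
  ultimately show ?thesis
    using that[of u "b + 1"] u(1) by simp
qed

section \<open>Charges given by a density\<close>

context bounded_charge
begin

text \<open>
  The indefinite integral of \<^term>\<open>\<rho>\<close> as a set function; it is a bounded charge when
  \<^term>\<open>\<rho>\<close> has a determining sequence.
\<close>

definition density_charge :: "('a \<Rightarrow> 'f) \<Rightarrow> 'a set \<Rightarrow> 'f" where
  "density_charge \<rho> A = int_over X m (\<lambda>x. indicator A x *\<^sub>R \<rho> x)"

lemma determining_indicator:
  assumes s: "determining s \<rho>" and A: "A \<in> zero_set_algebra X"
  shows "determining (\<lambda>n x. indicator A x * s n x) (\<lambda>x. indicator A x *\<^sub>R \<rho> x)"
proof -
  have "norm (indicator A x :: 'f) \<le> 1" for x
    by (simp add: indicator_def)
  then have "determining (\<lambda>n x. indicator A x * s n x) (\<lambda>x. indicator A x * \<rho> x)"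
    by (rule determining_mult[OF s simple_fun_indicator[OF A] uniform_limit_const zero_less_one])
  moreover have "(\<lambda>x. indicator A x * \<rho> x) = (\<lambda>x. indicator A x *\<^sub>R \<rho> x)"
    by (auto simp: indicator_def)
  ultimately show ?thesis
    by simp
qed

lemma density_charge_tendsto:
  assumes "determining s \<rho>" "A \<in> zero_set_algebra X"
  shows "(\<lambda>n. simple_int X m (\<lambda>x. indicator A x * s n x)) \<longlonglongrightarrow> density_charge \<rho> A"
  unfolding density_charge_def
  by (rule determining_tendsto_int_over[OF determining_indicator[OF assms]])

lemma density_charge_additive:
  assumes s: "determining s \<rho>"
  shows "Measure_Space.additive (zero_set_algebra X) (density_charge \<rho>)"
  unfolding Measure_Space.additive_def
proof (intro ballI impI)
  fix A B assume AB: "A \<in> zero_set_algebra X" "B \<in> zero_set_algebra X" "A \<inter> B = {}"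
  let ?I = "\<lambda>A n. simple_int X m (\<lambda>x. indicator A x * s n x)"
  have i: "simple_fun X (\<lambda>x. indicator A x * s n x)" if "A \<in> zero_set_algebra X" for A n
    using determining_simple[OF determining_indicator[OF s that]] .
  have "?I (A \<union> B) n = ?I A n + ?I B n" for n
  proof -
    have "(\<lambda>x. indicator (A \<union> B) x * s n x) = (\<lambda>x. indicator A x * s n x + indicator B x * s n x)"
    proof
      show "indicator (A \<union> B) x * s n x = indicator A x * s n x + indicator B x * s n x" for x
        using AB(3) by (cases "x \<in> A"; cases "x \<in> B") auto
    qed
    then show ?thesis
      using simple_int_add[OF additive i[OF AB(1), of n] i[OF AB(2), of n]] by simp
  qed
  moreover have "(\<lambda>n. ?I A n + ?I B n) \<longlonglongrightarrow> density_charge \<rho> A + density_charge \<rho> B"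
    using AB by (intro tendsto_add density_charge_tendsto[OF s]) auto
  moreover have "?I (A \<union> B) \<longlonglongrightarrow> density_charge \<rho> (A \<union> B)"
    using AB by (intro density_charge_tendsto[OF s]) auto
  ultimately show "density_charge \<rho> (A \<union> B) = density_charge \<rho> A + density_charge \<rho> B"
    using LIMSEQ_unique by simp
qed

lemma density_charge_bounded:
  assumes s: "determining s \<rho>"
  shows "bounded (density_charge \<rho> ` zero_set_algebra X)"
proof -
  obtain C where C: "\<And>n. mean (\<lambda>x. norm (s n x)) \<le> C"
    using determining_mean_bounded[OF s] by blast
  have "norm (density_charge \<rho> A) \<le> C" if A: "A \<in> zero_set_algebra X" for A
  proof (rule LIMSEQ_le_const2[OF tendsto_norm[OF density_charge_tendsto[OF s A]]], intro exI allI impI)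
    fix n
    have "norm (simple_int X m (\<lambda>x. indicator A x * s n x)) \<le> mean (\<lambda>x. norm (indicator A x * s n x))"
      by (rule norm_simple_int_le[OF determining_simple[OF determining_indicator[OF s A]]])
    also have "\<dots> \<le> 1 * mean (\<lambda>x. norm (s n x))"
      by (rule mean_norm_mult_le[OF simple_fun_indicator[OF A] determining_simple[OF s]])
        (auto simp: indicator_def)
    finally show "norm (simple_int X m (\<lambda>x. indicator A x * s n x)) \<le> C"
      using C[of n] by simp
  qed
  then show ?thesis
    by (auto simp: bounded_iff)
qed

text \<open>Absolute continuity of the indefinite integral.\<close>

lemma density_charge_small:
  assumes s: "determining s \<rho>" and e: "0 < e"
  obtains \<delta> where "0 < \<delta>"
    "\<And>A. A \<in> zero_set_algebra X \<Longrightarrow> variation X m A < \<delta> \<Longrightarrow> norm (density_charge \<rho> A) \<le> e"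
proof -
  note ss = determining_simple[OF s]
  obtain N where N: "\<And>n k. N \<le> n \<Longrightarrow> N \<le> k \<Longrightarrow> mean (\<lambda>x. norm (s n x - s k x)) < e / 2"
    using determining_Cauchy[OF s half_gt_zero[OF e]] by blast
  have "finite (s N ` topspace X)"
    using ss[of N] by (simp add: simple_fun_def)
  then have "bounded (s N ` topspace X)"
    by (rule finite_imp_bounded)
  then obtain K where K: "0 < K" "\<And>x. x \<in> topspace X \<Longrightarrow> norm (s N x) \<le> K"
    unfolding bounded_pos by blast
  have "norm (density_charge \<rho> A) \<le> e"
    if A: "A \<in> zero_set_algebra X" and small: "variation X m A < e / (2 * K)" for A
  proof (rule LIMSEQ_le_const2[OF tendsto_norm[OF density_charge_tendsto[OF s A]]],
      intro exI[of _ N] allI impI)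
    fix n assume n: "N \<le> n"
    have a: "simple_fun X (\<lambda>x. norm (s n x - s N x))"
      by (rule simple_fun_compose2[OF ss ss])
    have b: "simple_fun X (\<lambda>x. K * indicator A x)"
      by (rule simple_fun_compose[OF simple_fun_indicator[OF A]])
    have c: "simple_fun X (\<lambda>x. indicator A x * s n x)"
      by (rule determining_simple[OF determining_indicator[OF s A]])
    have "norm (simple_int X m (\<lambda>x. indicator A x * s n x)) \<le> mean (\<lambda>x. norm (indicator A x * s n x))"
      by (rule norm_simple_int_le[OF c])
    also have "\<dots> \<le> mean (\<lambda>x. norm (s n x - s N x) + K * indicator A x)"
    proof (rule mean_mono)
      fix x assume x: "x \<in> topspace X"
      have "norm (s n x) \<le> norm (s n x - s N x) + K"
        using K(2)[OF x] norm_triangle_sub[of "s n x" "s N x"] by linarith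
      then show "norm (indicator A x * s n x) \<le> norm (s n x - s N x) + K * indicator A x"
        by (simp add: indicator_def)
    qed (rule simple_fun_compose[OF c] simple_fun_compose2[OF a b])+
    also have "\<dots> = mean (\<lambda>x. norm (s n x - s N x)) + mean (\<lambda>x. K * indicator A x)"
      by (rule simple_int_add[OF variation_additive a b])
    also have "mean (\<lambda>x. K * indicator A x) = K * variation X m A"
      by (simp only: simple_int_cmult[OF variation_additive simple_fun_indicator[OF A]]
          simple_int_indicator[OF variation_additive A])
    also have "mean (\<lambda>x. norm (s n x - s N x)) + K * variation X m A \<le> e / 2 + K * (e / (2 * K))"
      using N[OF n order_refl] small K(1) by (intro add_mono mult_left_mono) auto
    also have "\<dots> = e"
      using K(1) by simp
    finally show "norm (simple_int X m (\<lambda>x. indicator A x * s n x)) \<le> e" .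
  qed
  moreover have "0 < e / (2 * K)"
    using e K(1) by simp
  ultimately show ?thesis
    using that by blast
qed

lemma density_charge_null:
  assumes s: "determining s \<rho>" and A: "A \<in> zero_set_algebra X" "variation X m A = 0"
  shows "density_charge \<rho> A = 0"
proof -
  have "norm (density_charge \<rho> A) \<le> e" if e: "0 < e" for e
    using density_charge_small[OF s e] A by metis
  then show ?thesis
    by (metis dense_ge norm_le_zero_iff)
qed

lemma simple_int_density_charge_tendsto:
  assumes s: "determining s \<rho>" and u: "simple_fun X u"
  shows "(\<lambda>k. simple_int X m (\<lambda>x. u x * s k x)) \<longlonglongrightarrow> simple_int X (density_charge \<rho>) u"
proof -
  have "{x \<in> topspace X. u x = y} \<in> zero_set_algebra X" for y
    using u by (simp add: simple_fun_def)
  then show ?thesis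
    unfolding simple_int_mult_decompose[OF additive u determining_simple[OF s]] simple_int_def[of X "density_charge \<rho>"]
    by (intro tendsto_sum tendsto_mult tendsto_const density_charge_tendsto[OF s])
qed

text \<open>
  The change of measure formula: integrating \<^term>\<open>w\<close> against the indefinite integral of \<^term>\<open>\<rho>\<close>
  amounts to integrating \<^term>\<open>\<lambda>x. w x * \<rho> x\<close>.
\<close>

lemma density_charge_uniform_limit:
  assumes s: "determining s \<rho>"
    and u: "\<And>n. simple_fun X (u n)" and unif: "uniform_limit (topspace X) u w sequentially"
    and K: "0 < K" "\<And>n x. x \<in> topspace X \<Longrightarrow> norm (u n x) \<le> K"
  shows "int_exists X m (\<lambda>x. w x * \<rho> x)"
    and "(\<lambda>n. simple_int X (density_charge \<rho>) (u n)) \<longlonglongrightarrow> int_over X m (\<lambda>x. w x * \<rho> x)"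
proof -
  note ss = determining_simple[OF s]
  have det: "determining (\<lambda>n x. u n x * s n x) (\<lambda>x. w x * \<rho> x)"
    by (rule determining_mult[OF s u unif K])
  then show "int_exists X m (\<lambda>x. w x * \<rho> x)"
    using int_exists_iff_determining by blast
  let ?I = "int_over X m (\<lambda>x. w x * \<rho> x)"
  obtain C where C: "0 < C" "\<And>n. mean (\<lambda>x. norm (s n x)) \<le> C"
    using determining_mean_bounded[OF s] by blast
  show "(\<lambda>n. simple_int X (density_charge \<rho>) (u n)) \<longlonglongrightarrow> ?I"
  proof (rule LIMSEQ_I)
    fix e :: real assume e: "0 < e"
    define \<eta> where "\<eta> = e / (4 * C)"
    have \<eta>: "0 < \<eta>"
      using e C(1) by (simp add: \<eta>_def)
    obtain N where N: "\<And>n x. N \<le> n \<Longrightarrow> x \<in> topspace X \<Longrightarrow> norm (u n x - w x) < \<eta>"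
      using unif \<eta> unfolding uniform_limit_sequentially_iff dist_norm by blast
    have "norm (simple_int X (density_charge \<rho>) (u n) - ?I) \<le> e / 2" if n: "N \<le> n" for n
    proof (rule LIMSEQ_le_const2[OF tendsto_norm[OF tendsto_diff[OF
              simple_int_density_charge_tendsto[OF s u[of n]] determining_tendsto_int_over[OF det]]]],
        intro exI[of _ N] allI impI)
      fix k assume k: "N \<le> k"
      have p: "simple_fun X (\<lambda>x. u n x * s k x)" "simple_fun X (\<lambda>x. u k x * s k x)"
        by (rule simple_fun_compose2[OF u ss])+
      have d: "simple_fun X (\<lambda>x. u n x - u k x)"
        by (rule simple_fun_compose2[OF u u])
      have dp: "simple_fun X (\<lambda>x. (u n x - u k x) * s k x)"
        by (rule simple_fun_compose2[OF d ss])
      have "simple_int X m (\<lambda>x. u n x * s k x) - simple_int X m (\<lambda>x. u k x * s k x) =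
          simple_int X m (\<lambda>x. (u n x - u k x) * s k x)"
        unfolding simple_int_diff[OF additive p, symmetric] by (simp add: left_diff_distrib)
      also have "norm \<dots> \<le> mean (\<lambda>x. norm ((u n x - u k x) * s k x))"
        by (rule norm_simple_int_le[OF dp])
      also have "\<dots> \<le> (2 * \<eta>) * mean (\<lambda>x. norm (s k x))"
      proof (rule mean_norm_mult_le[OF d ss])
        fix x assume x: "x \<in> topspace X"
        have "norm (u n x - u k x) \<le> norm (u n x - w x) + norm (u k x - w x)"
          by (metis dist_norm dist_triangle2)
        also have "\<dots> \<le> 2 * \<eta>"
          using N[OF n x] N[OF k x] by simp
        finally show "norm (u n x - u k x) \<le> 2 * \<eta>" .
      qed (use \<eta> in simp)
      also have "\<dots> \<le> (2 * \<eta>) * C"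
        using \<eta> C(2) by (intro mult_left_mono) auto
      also have "\<dots> = e / 2"
        using C(1) by (simp add: \<eta>_def)
      finally show "norm (simple_int X m (\<lambda>x. u n x * s k x) - simple_int X m (\<lambda>x. u k x * s k x)) \<le> e / 2" .
    qed
    then show "\<exists>no. \<forall>n\<ge>no. norm (simple_int X (density_charge \<rho>) (u n) - ?I) < e"
      using e by (intro exI[of _ N]) fastforce
  qed
qed

section \<open>Regular charges are determined by the integrals of bounded continuous functions\<close>

lemma int_bounded_continuous:
  fixes w :: "'a \<Rightarrow> 'f"
  assumes "continuous_map X euclidean w" "bounded (w ` topspace X)"
  shows "int_exists X m w"
  using bounded_continuous_uniform_limit[OF assms] determining_uniform_limit int_exists_iff_determining
  by metis

end

lemma zero_sets_Urysohn:
  assumes "Z \<in> zero_sets X" "W \<in> zero_sets X" "Z \<inter> W = {}"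
  obtains f :: "'a \<Rightarrow> real" where "continuous_map X euclidean f" "\<And>x. x \<in> topspace X \<Longrightarrow> 0 \<le> f x \<and> f x \<le> 1"
    "\<And>x. x \<in> Z \<Longrightarrow> f x = 1" "\<And>x. x \<in> W \<Longrightarrow> f x = 0"
proof -
  obtain z where z: "Z = {x \<in> topspace X. z x = (0::real)}" "continuous_map X euclidean z"
    using assms(1) by (auto simp: zero_sets_def bdd_cont_funs_def cont_funs_def)
  obtain w where w: "W = {x \<in> topspace X. w x = (0::real)}" "continuous_map X euclidean w"
    using assms(2) by (auto simp: zero_sets_def bdd_cont_funs_def cont_funs_def)
  have nz: "\<bar>z x\<bar> + \<bar>w x\<bar> \<noteq> 0" if "x \<in> topspace X" for x
    using that assms(3) z(1) w(1) by auto
  show ?thesis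
  proof
    show "continuous_map X euclidean (\<lambda>x. \<bar>w x\<bar> / (\<bar>z x\<bar> + \<bar>w x\<bar>))"
      using z(2) w(2) nz by (intro continuous_map_real_divide continuous_map_add continuous_map_real_abs) auto
    show "0 \<le> \<bar>w x\<bar> / (\<bar>z x\<bar> + \<bar>w x\<bar>) \<and> \<bar>w x\<bar> / (\<bar>z x\<bar> + \<bar>w x\<bar>) \<le> 1" for x
      by (simp add: divide_le_eq_1) linarith
    show "\<bar>w x\<bar> / (\<bar>z x\<bar> + \<bar>w x\<bar>) = 1" if "x \<in> Z" for x
      using that z(1) nz[of x] by simp
    show "\<bar>w x\<bar> / (\<bar>z x\<bar> + \<bar>w x\<bar>) = 0" if "x \<in> W" for x
      using that w(1) by simp
  qed
qed

context bounded_charge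
begin

text \<open>
  The uniqueness part of the Riesz--Alexandroff representation theorem. A zero set \<^term>\<open>Z\<close> and a zero
  set \<^term>\<open>W\<close> exhausting its complement up to small variation are separated by a bounded continuous
  function, whose integral differs little from \<^term>\<open>m Z\<close>. Regularity extends the conclusion from zero
  sets to the whole algebra.
\<close>

lemma regular_charge_eq_0:
  assumes reg: "\<And>A \<epsilon>. A \<in> zero_set_algebra X \<Longrightarrow> 0 < \<epsilon> \<Longrightarrow> \<exists>Z\<in>zero_sets X. Z \<subseteq> A \<and> variation X m (A - Z) < \<epsilon>"
    and zero: "\<And>f. f \<in> bdd_cont_funs X \<Longrightarrow> int_over X m f = 0"
    and A: "A \<in> zero_set_algebra X"
  shows "m A = 0"
proof -
  have in_alg: "Z \<in> zero_set_algebra X" if "Z \<in> zero_sets X" for Z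
    using that zero_sets_subset_algebra by blast
  have zero_set: "m Z = 0" if Z: "Z \<in> zero_sets X" for Z
  proof -
    have Z': "Z \<in> zero_set_algebra X"
      by (rule in_alg[OF Z])
    have "norm (m Z) \<le> \<epsilon>" if \<epsilon>: "0 < \<epsilon>" for \<epsilon>
    proof -
      have "topspace X - Z \<in> zero_set_algebra X"
        using Z' by (rule zsa.compl_sets)
      then obtain W where W: "W \<in> zero_sets X" "W \<subseteq> topspace X - Z"
          "variation X m (topspace X - Z - W) < \<epsilon>"
        using reg[OF _ \<epsilon>] by blast
      define R where "R = topspace X - Z - W"
      have R: "R \<in> zero_set_algebra X"
        unfolding R_def using Z' in_alg[OF W(1)] by (intro zsa.Diff zsa.compl_sets)
      obtain f :: "'a \<Rightarrow> real" where f: "continuous_map X euclidean f"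
          "\<And>x. x \<in> topspace X \<Longrightarrow> 0 \<le> f x \<and> f x \<le> 1"
          "\<And>x. x \<in> Z \<Longrightarrow> f x = 1" "\<And>x. x \<in> W \<Longrightarrow> f x = 0"
        using zero_sets_Urysohn[OF Z W(1)] W(2) by blast
      define w where "w x = (of_real (f x) :: 'f)" for x
      have w1: "continuous_map X euclidean w"
        using f(1) by (simp add: w_def[abs_def] continuous_map_atin tendsto_of_real)
      have w2: "bounded (w ` topspace X)"
        unfolding bounded_iff w_def using f(2) by (intro exI[of _ 1]) auto
      obtain u :: "nat \<Rightarrow> 'a \<Rightarrow> 'f" and K where u: "\<And>n. simple_fun X (u n)"
          "uniform_limit (topspace X) u w sequentially"
          "0 < K" "\<And>n x. x \<in> topspace X \<Longrightarrow> norm (u n x) \<le> K"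
        using bounded_continuous_uniform_limit[OF w1 w2] by blast
      have "int_over X m w = 0"
        using w1 w2 by (intro zero) (simp add: bdd_cont_funs_def cont_funs_def)
      then have "(\<lambda>n. simple_int X m (u n)) \<longlonglongrightarrow> 0"
        using determining_tendsto_int_over[OF determining_uniform_limit[OF u]] by simp
      from tendsto_diff[OF this tendsto_const[of "m Z"]]
      have lim: "(\<lambda>n. norm (simple_int X m (u n) - m Z)) \<longlonglongrightarrow> norm (m Z)"
        using tendsto_norm by fastforce
      define V where "V = variation X m (topspace X) + 1"
      have V: "0 < V"
        using variation_nonneg[OF zsa.top] by (simp add: V_def add_nonneg_pos)
      have "norm (m Z) \<le> variation X m R + \<eta> * V" if \<eta>: "0 < \<eta>" for \<eta>
      proof -
        obtain N where N: "\<And>n x. N \<le> n \<Longrightarrow> x \<in> topspace X \<Longrightarrow> norm (u n x - w x) < \<eta>"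
          using u(2) \<eta> unfolding uniform_limit_sequentially_iff dist_norm by blast
        have "norm (simple_int X m (u n) - m Z) \<le> variation X m R + \<eta> * V" if n: "N \<le> n" for n
        proof -
          have iZ: "simple_fun X (indicator Z :: 'a \<Rightarrow> 'f)"
            by (rule simple_fun_indicator[OF Z'])
          have iR: "simple_fun X (indicator R :: 'a \<Rightarrow> real)"
            by (rule simple_fun_indicator[OF R])
          have iX: "simple_fun X (indicator (topspace X) :: 'a \<Rightarrow> real)"
            by (rule simple_fun_indicator[OF zsa.top])
          have cX: "simple_fun X (\<lambda>x. \<eta> * indicator (topspace X) x)"
            by (rule simple_fun_compose[OF iX])
          have d: "simple_fun X (\<lambda>x. u n x - indicator Z x)"
            by (rule simple_fun_compose2[OF u(1) iZ])
          have "simple_int X m (u n) - m Z = simple_int X m (\<lambda>x. u n x - indicator Z x)"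
            by (simp only: simple_int_diff[OF additive u(1) iZ] simple_int_indicator[OF additive Z'])
          also have "norm \<dots> \<le> mean (\<lambda>x. norm (u n x - indicator Z x))"
            by (rule norm_simple_int_le[OF d])
          also have "\<dots> \<le> mean (\<lambda>x. indicator R x + \<eta> * indicator (topspace X) x)"
          proof (rule mean_mono)
            fix x assume x: "x \<in> topspace X"
            have "norm (w x - indicator Z x) \<le> indicator R x"
              using f(2)[OF x] f(3,4)[of x] x W(2) by (auto simp: indicator_def R_def w_def)
            then show "norm (u n x - indicator Z x) \<le> indicator R x + \<eta> * indicator (topspace X) x"
              using norm_triangle_ineq[of "u n x - w x" "w x - indicator Z x"] N[OF n x] x by simp
          qed (rule simple_fun_compose[OF d] simple_fun_compose2[OF iR cX])+
          also have "\<dots> = variation X m R + \<eta> * variation X m (topspace X)"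
            by (simp only: simple_int_add[OF variation_additive iR cX]
                simple_int_cmult[OF variation_additive iX]
                simple_int_indicator[OF variation_additive R]
                simple_int_indicator[OF variation_additive zsa.top])
          also have "\<dots> \<le> variation X m R + \<eta> * V"
            using \<eta> by (simp add: V_def)
          finally show ?thesis .
        qed
        then show ?thesis
          by (intro LIMSEQ_le_const2[OF lim] exI[of _ N]) blast
      qed
      \<comment> \<open>This choice makes the right-hand side equal to \<^term>\<open>\<epsilon>\<close>; it is positive because
        \<^term>\<open>R\<close> has variation less than \<^term>\<open>\<epsilon>\<close>.\<close>
      from this[of "(\<epsilon> - variation X m R) / V"] show ?thesis
        using W(3) V by (simp add: R_def)
    qed
    then show ?thesis
      by (metis dense_ge norm_le_zero_iff)
  qed
  have "norm (m A) \<le> \<epsilon>" if \<epsilon>: "0 < \<epsilon>" for \<epsilon>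
  proof -
    obtain Z where Z: "Z \<in> zero_sets X" "Z \<subseteq> A" "variation X m (A - Z) < \<epsilon>"
      using reg[OF A \<epsilon>] by blast
    have Z': "Z \<in> zero_set_algebra X" "A - Z \<in> zero_set_algebra X"
      using in_alg[OF Z(1)] A by auto
    have "Z \<union> (A - Z) = A"
      using Z(2) by blast
    then have "m A = m Z + m (A - Z)"
      using additive_Un[OF additive Z'] by simp
    then show ?thesis
      using zero_set[OF Z(1)] norm_le_variation[OF Z'(2) Z'(2) order_refl] Z(3) by simp
  qed
  then show ?thesis
    by (metis dense_ge norm_le_zero_iff)
qed

end

section \<open>Transport of a charge along a homeomorphism\<close>

lemma homeomorphic_maps_image_eq:
  assumes "homeomorphic_maps X X \<phi> \<psi>" "A \<subseteq> topspace X"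
  shows "\<psi> ` A = {x \<in> topspace X. \<phi> x \<in> A}"
proof -
  have 1: "\<psi> y \<in> topspace X" "\<phi> (\<psi> y) = y" if "y \<in> topspace X" for y
    using assms(1) that by (auto simp: homeomorphic_maps_def continuous_map_def)
  have 2: "\<psi> (\<phi> x) = x" if "x \<in> topspace X" for x
    using assms(1) that by (auto simp: homeomorphic_maps_def)
  show ?thesis
  proof (intro equalityI subsetI)
    fix x assume "x \<in> \<psi> ` A"
    then show "x \<in> {x \<in> topspace X. \<phi> x \<in> A}"
      using 1 assms(2) by auto
  next
    fix x assume x: "x \<in> {x \<in> topspace X. \<phi> x \<in> A}"
    then have "x = \<psi> (\<phi> x)"
      using 2 by simp
    then show "x \<in> \<psi> ` A"
      using x by blast
  qed
qed

lemma homeomorphic_maps_zero_sets: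
  assumes h: "homeomorphic_maps X X \<phi> \<psi>" and Z: "Z \<in> zero_sets X"
  shows "\<psi> ` Z \<in> zero_sets X"
proof -
  obtain f where f: "Z = {x \<in> topspace X. f x = (0::real)}" "continuous_map X euclidean f"
      "bounded (f ` topspace X)"
    using Z by (auto simp: zero_sets_def bdd_cont_funs_def cont_funs_def)
  have \<phi>: "continuous_map X X \<phi>"
    using h by (simp add: homeomorphic_maps_def)
  have \<phi>_in: "\<phi> x \<in> topspace X" if "x \<in> topspace X" for x
    using \<phi> that by (auto simp: continuous_map_def)
  have "Z \<subseteq> topspace X"
    unfolding f(1) by blast
  from homeomorphic_maps_image_eq[OF h this]
  have "\<psi> ` Z = {x \<in> topspace X. f (\<phi> x) = 0}"
    using \<phi>_in by (auto simp: f(1))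
  moreover have "continuous_map X euclidean (\<lambda>x. f (\<phi> x))"
    using continuous_map_compose[OF \<phi> f(2)] by (simp add: comp_def)
  moreover have "bounded ((\<lambda>x. f (\<phi> x)) ` topspace X)"
    using \<phi>_in by (intro bounded_subset[OF f(3)]) auto
  ultimately show ?thesis
    using zero_setsI by metis
qed

text \<open>
  A bounded charge together with a homeomorphism \<^term>\<open>\<psi>\<close> along which it is pulled back, and the inverse
  \<^term>\<open>\<phi>\<close>, which enters the change of variables formula. The images of the sets of the algebra under
  \<^term>\<open>\<psi>\<close> are required to lie in the algebra.
\<close>

locale transported_charge = bounded_charge X m
  for X :: "'a topology" and m :: "'a set \<Rightarrow> 'f::{real_normed_field, euclidean_space}" +
  fixes \<phi> \<psi> :: "'a \<Rightarrow> 'a"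
  assumes homeo: "homeomorphic_maps X X \<phi> \<psi>"
    and image_closed: "A \<in> zero_set_algebra X \<Longrightarrow> \<psi> ` A \<in> zero_set_algebra X"
begin

abbreviation transport :: "'a set \<Rightarrow> 'f" where
  "transport \<equiv> \<lambda>A. m (\<psi> ` A)"

lemma image_Int_eq:
  assumes "A \<in> zero_set_algebra X" "B \<in> zero_set_algebra X"
  shows "\<psi> ` A \<inter> \<psi> ` B = \<psi> ` (A \<inter> B)"
proof -
  have "inj_on \<psi> (topspace X)"
    by (rule inj_on_inverseI[of _ \<phi>]) (use homeo in \<open>simp add: homeomorphic_maps_def\<close>)
  from inj_on_image_Int[OF this zsa.sets_into_space[OF assms(1)] zsa.sets_into_space[OF assms(2)]]
  show ?thesis ..
qed

lemma transport_charge: "bounded_charge X transport"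
proof
  show "Measure_Space.additive (zero_set_algebra X) transport"
    unfolding Measure_Space.additive_def
  proof (intro ballI impI)
    fix A B assume AB: "A \<in> zero_set_algebra X" "B \<in> zero_set_algebra X" "A \<inter> B = {}"
    then have "\<psi> ` A \<inter> \<psi> ` B = {}"
      by (simp add: image_Int_eq)
    then show "m (\<psi> ` (A \<union> B)) = m (\<psi> ` A) + m (\<psi> ` B)"
      unfolding image_Un using AB by (intro additive_Un[OF additive] image_closed)
  qed
  show "bounded (transport ` zero_set_algebra X)"
    using image_closed by (intro bounded_subset[OF bounded]) auto
qed

lemma variation_transport_le:
  assumes A: "A \<in> zero_set_algebra X"
  shows "variation X transport A \<le> variation X m (\<psi> ` A)"
proof (rule bounded_charge.variation_least[OF transport_charge A])
  fix P assume P: "finite P" "P \<subseteq> zero_set_algebra X" "partition_on A P"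
  show "(\<Sum>B\<in>P. norm (m (\<psi> ` B))) \<le> variation X m (\<psi> ` A)"
  proof (rule sum_norm_le_variation[OF P(1)])
    show "\<psi> ` B \<in> zero_set_algebra X" if "B \<in> P" for B
      using P(2) that by (intro image_closed) auto
    show "disjoint_family_on (\<lambda>B. \<psi> ` B) P"
      unfolding disjoint_family_on_def
    proof (intro ballI impI)
      fix B C assume "B \<in> P" "C \<in> P" "B \<noteq> C"
      then have "B \<inter> C = {}" "B \<in> zero_set_algebra X" "C \<in> zero_set_algebra X"
        using P(2) disjointD[OF partition_onD2[OF P(3)]] by auto
      then show "\<psi> ` B \<inter> \<psi> ` C = {}"
        by (simp add: image_Int_eq)
    qed
    show "\<psi> ` A \<in> zero_set_algebra X"
      by (rule image_closed[OF A])
    show "(\<Union>B\<in>P. \<psi> ` B) \<subseteq> \<psi> ` A"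
      unfolding partition_onD1[OF P(3)] by blast
  qed
qed

lemma transport_regular:
  assumes reg: "\<And>A \<epsilon>. A \<in> zero_set_algebra X \<Longrightarrow> 0 < \<epsilon> \<Longrightarrow> \<exists>Z\<in>zero_sets X. Z \<subseteq> A \<and> variation X m (A - Z) < \<epsilon>"
    and A: "A \<in> zero_set_algebra X" and \<epsilon>: "0 < \<epsilon>"
  obtains Z where "Z \<in> zero_sets X" "Z \<subseteq> A" "variation X transport (A - Z) < \<epsilon>"
proof -
  obtain Z where Z: "Z \<in> zero_sets X" "Z \<subseteq> \<psi> ` A" "variation X m (\<psi> ` A - Z) < \<epsilon>"
    using reg[OF image_closed[OF A] \<epsilon>] by blast
  have Zs: "\<phi> ` Z \<in> zero_sets X"
    using homeo Z(1) homeomorphic_maps_sym by (metis homeomorphic_maps_zero_sets)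
  have inv1: "\<phi> (\<psi> y) = y" if "y \<in> topspace X" for y
    using homeo that by (auto simp: homeomorphic_maps_def)
  have inv2: "\<psi> (\<phi> y) = y" if "y \<in> topspace X" for y
    using homeo that by (auto simp: homeomorphic_maps_def)
  have AX: "A \<subseteq> topspace X"
    by (rule zsa.sets_into_space[OF A])
  have ZX: "Z \<subseteq> topspace X"
    using Z(2) zsa.sets_into_space[OF image_closed[OF A]] by blast
  have ZA: "\<phi> ` Z \<subseteq> A"
  proof
    fix x assume "x \<in> \<phi> ` Z"
    then obtain a where "a \<in> A" "x = \<phi> (\<psi> a)"
      using Z(2) by blast
    then show "x \<in> A"
      using inv1 AX by auto
  qed
  have Zs': "\<phi> ` Z \<in> zero_set_algebra X"
    using Zs zero_sets_subset_algebra by blast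
  have D: "A - \<phi> ` Z \<in> zero_set_algebra X"
    by (rule zsa.Diff[OF A Zs'])
  have "\<psi> ` (A - \<phi> ` Z) = \<psi> ` A - Z"
  proof -
    have inj: "inj_on \<psi> (topspace X)"
      using inv1 by (rule inj_on_inverseI)
    have "\<psi> ` (A - \<phi> ` Z) = \<psi> ` A - \<psi> ` \<phi> ` Z"
      using AX ZA by (intro inj_on_image_set_diff[OF inj]) auto
    also have "\<psi> ` \<phi> ` Z = Z"
    proof -
      have "\<psi> ` \<phi> ` Z = id ` Z"
        unfolding image_image using inv2 ZX by (intro image_cong) auto
      then show ?thesis
        by simp
    qed
    finally show ?thesis .
  qed
  then have "variation X transport (A - \<phi> ` Z) < \<epsilon>"
    using variation_transport_le[OF D] Z(3) by simp
  then show ?thesis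
    using that Zs ZA by blast
qed

lemma image_topspace: "\<phi> ` topspace X = topspace X"
proof -
  have "\<phi> x \<in> topspace X" if "x \<in> topspace X" for x
    using homeo that by (auto simp: homeomorphic_maps_def continuous_map_def)
  moreover have "x = \<phi> (\<psi> x)" "\<psi> x \<in> topspace X" if "x \<in> topspace X" for x
    using homeo that by (auto simp: homeomorphic_maps_def continuous_map_def)
  ultimately show ?thesis
    by blast
qed

lemma level_set_transport: "{x \<in> topspace X. u (\<phi> x) = y} = \<psi> ` {x \<in> topspace X. u x = y}"
proof -
  have "{x \<in> topspace X. u x = y} \<subseteq> topspace X"
    by blast
  from homeomorphic_maps_image_eq[OF homeo this] show ?thesis
    using image_topspace by auto
qed

lemma simple_fun_transport:
  assumes "simple_fun X u"
  shows "simple_fun X (\<lambda>x. u (\<phi> x))"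
proof -
  have "(\<lambda>x. u (\<phi> x)) ` topspace X = u ` topspace X"
    using image_topspace by (metis image_image)
  then show ?thesis
    using assms unfolding simple_fun_def level_set_transport by (auto intro: image_closed)
qed

lemma simple_int_transport: "simple_int X transport u = simple_int X m (\<lambda>x. u (\<phi> x))"
proof -
  have "(\<lambda>x. u (\<phi> x)) ` topspace X = u ` topspace X"
    using image_topspace by (metis image_image)
  then show ?thesis
    unfolding simple_int_def level_set_transport by simp
qed

lemma uniform_limit_transport:
  assumes "uniform_limit (topspace X) u w F"
  shows "uniform_limit (topspace X) (\<lambda>n x. u n (\<phi> x)) (\<lambda>x. w (\<phi> x)) F"
  unfolding uniform_limit_iff
proof (intro allI impI)
  fix e :: real assume "0 < e"
  then have "\<forall>\<^sub>F n in F. \<forall>x\<in>topspace X. dist (u n x) (w x) < e"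
    using assms unfolding uniform_limit_iff by blast
  then show "\<forall>\<^sub>F n in F. \<forall>x\<in>topspace X. dist (u n (\<phi> x)) (w (\<phi> x)) < e"
    by (rule eventually_mono) (use image_topspace in blast)
qed

end

section \<open>Charges that are transported to a density\<close>

context transported_charge
begin

lemma simple_int_transport_tendsto:
  fixes w :: "'a \<Rightarrow> 'f"
  assumes u: "\<And>n. simple_fun X (u n)" "uniform_limit (topspace X) u w sequentially"
      "0 < K" "\<And>n x. x \<in> topspace X \<Longrightarrow> norm (u n x) \<le> K"
  shows "(\<lambda>n. simple_int X transport (u n)) \<longlonglongrightarrow> int_over X m (\<lambda>x. w (\<phi> x))"
proof -
  have "norm (u n (\<phi> x)) \<le> K" if "x \<in> topspace X" for n x
    using u(4) image_topspace that by blast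
  then have "determining (\<lambda>n x. u n (\<phi> x)) (\<lambda>x. w (\<phi> x))"
    by (rule determining_uniform_limit[OF simple_fun_transport[OF u(1)] uniform_limit_transport[OF u(2)] u(3)])
  then show ?thesis
    unfolding simple_int_transport by (rule determining_tendsto_int_over)
qed

lemma int_transport_density:
  fixes w :: "'a \<Rightarrow> 'f"
  assumes s: "determining s \<rho>"
    and eq: "\<And>A. A \<in> zero_set_algebra X \<Longrightarrow> m (\<psi> ` A) = density_charge \<rho> A"
    and w: "continuous_map X euclidean w" "bounded (w ` topspace X)"
  shows "int_exists X m (\<lambda>x. w x * \<rho> x)"
    and "int_over X m (\<lambda>x. w (\<phi> x)) = int_over X m (\<lambda>x. w x * \<rho> x)"
proof -
  obtain u :: "nat \<Rightarrow> 'a \<Rightarrow> 'f" and K where u: "\<And>n. simple_fun X (u n)"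
      "uniform_limit (topspace X) u w sequentially"
      "0 < K" "\<And>n x. x \<in> topspace X \<Longrightarrow> norm (u n x) \<le> K"
    using bounded_continuous_uniform_limit[OF w] by blast
  show "int_exists X m (\<lambda>x. w x * \<rho> x)"
    by (rule density_charge_uniform_limit[OF s u])
  have "(\<lambda>n. simple_int X transport (u n)) \<longlonglongrightarrow> int_over X m (\<lambda>x. w (\<phi> x))"
    by (rule simple_int_transport_tendsto[OF u])
  moreover have "simple_int X transport (u n) = simple_int X (density_charge \<rho>) (u n)" for n
  proof -
    have "{x \<in> topspace X. u n x = y} \<in> zero_set_algebra X" for y
      using u(1) by (simp add: simple_fun_def)
    then show ?thesis
      unfolding simple_int_def by (simp add: eq)
  qed
  moreover have "(\<lambda>n. simple_int X (density_charge \<rho>) (u n)) \<longlonglongrightarrow> int_over X m (\<lambda>x. w x * \<rho> x)"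
    by (rule density_charge_uniform_limit[OF s u])
  ultimately show "int_over X m (\<lambda>x. w (\<phi> x)) = int_over X m (\<lambda>x. w x * \<rho> x)"
    using LIMSEQ_unique by simp
qed

text \<open>
  The difference of the transported charge and the indefinite integral is a charge that annihilates
  the bounded continuous functions. It is regular, since the first charge inherits regularity through
  the homeomorphism and the second through absolute continuity.
\<close>

lemma transport_eq_density_charge:
  assumes reg: "\<And>A \<epsilon>. A \<in> zero_set_algebra X \<Longrightarrow> 0 < \<epsilon> \<Longrightarrow> \<exists>Z\<in>zero_sets X. Z \<subseteq> A \<and> variation X m (A - Z) < \<epsilon>"
    and s: "determining s \<rho>"
    and eq: "\<And>w. w \<in> bdd_cont_funs X \<Longrightarrow>
      int_over X m (\<lambda>x. w (\<phi> x)) = int_over X m (\<lambda>x. w x * \<rho> x)"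
    and A: "A \<in> zero_set_algebra X"
  shows "m (\<psi> ` A) = density_charge \<rho> A"
proof -
  define \<Delta> where "\<Delta> A = m (\<psi> ` A) - density_charge \<rho> A" for A
  interpret T: bounded_charge X transport
    by (rule transport_charge)
  interpret \<Delta>: bounded_charge X \<Delta>
  proof
    show "Measure_Space.additive (zero_set_algebra X) \<Delta>"
      using T.additive density_charge_additive[OF s]
      unfolding Measure_Space.additive_def \<Delta>_def by simp
    have "bounded ((\<lambda>A. m (\<psi> ` A) - density_charge \<rho> A) ` zero_set_algebra X)"
      by (rule bounded_minus_comp[OF T.bounded density_charge_bounded[OF s]])
    then show "bounded (\<Delta> ` zero_set_algebra X)"
      by (simp only: \<Delta>_def[abs_def])
  qed
  have "\<Delta> A = 0"
  proof (rule \<Delta>.regular_charge_eq_0[OF _ _ A])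
    fix A and \<epsilon> :: real assume A: "A \<in> zero_set_algebra X" and \<epsilon>: "0 < \<epsilon>"
    \<comment> \<open>A bound \<^term>\<open>c\<close> for the values of the charge on the subsets of a set bounds its variation on
      that set by \<^term>\<open>2 * real DIM('f) * c\<close>.\<close>
    define c where "c = \<epsilon> / (4 * real DIM('f))"
    have c: "0 < c"
      using \<epsilon> by (simp add: c_def)
    obtain \<delta> where \<delta>: "0 < \<delta>"
        "\<And>A. A \<in> zero_set_algebra X \<Longrightarrow> variation X m A < \<delta> \<Longrightarrow> norm (density_charge \<rho> A) \<le> c / 2"
      using density_charge_small[OF s half_gt_zero[OF c]] by blast
    obtain Z1 where Z1: "Z1 \<in> zero_sets X" "Z1 \<subseteq> A" "variation X transport (A - Z1) < c / 2"
      using transport_regular[OF reg A half_gt_zero[OF c]] by blast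
    obtain Z2 where Z2: "Z2 \<in> zero_sets X" "Z2 \<subseteq> A" "variation X m (A - Z2) < \<delta>"
      using reg[OF A \<delta>(1)] by blast
    have Z': "Z1 \<in> zero_set_algebra X" "Z2 \<in> zero_set_algebra X"
      using Z1(1) Z2(1) zero_sets_subset_algebra by blast+
    have D: "A - Z1 \<in> zero_set_algebra X" "A - Z2 \<in> zero_set_algebra X" "A - (Z1 \<union> Z2) \<in> zero_set_algebra X"
      using A Z' by auto
    have "variation X \<Delta> (A - (Z1 \<union> Z2)) \<le> 2 * real DIM('f) * c"
    proof (rule \<Delta>.variation_le_bound[OF D(3)])
      fix C assume C: "C \<in> zero_set_algebra X" "C \<subseteq> A - (Z1 \<union> Z2)"
      then have sub: "C \<subseteq> A - Z1" "C \<subseteq> A - Z2"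
        by auto
      have "norm (m (\<psi> ` C)) \<le> c / 2"
        using T.norm_le_variation[OF D(1) C(1) sub(1)] Z1(3) by simp
      moreover have "norm (density_charge \<rho> C) \<le> c / 2"
        using variation_mono[OF C(1) D(2) sub(2)] Z2(3) by (intro \<delta>(2)[OF C(1)]) simp
      ultimately show "norm (\<Delta> C) \<le> c"
        unfolding \<Delta>_def using norm_triangle_ineq4[of "m (\<psi> ` C)" "density_charge \<rho> C"] by simp
    qed
    also have "\<dots> < \<epsilon>"
      using \<epsilon> by (simp add: c_def)
    finally show "\<exists>Z\<in>zero_sets X. Z \<subseteq> A \<and> variation X \<Delta> (A - Z) < \<epsilon>"
      using zero_sets_Un[OF Z1(1) Z2(1)] Z1(2) Z2(2) by blast
  next
    fix w :: "'a \<Rightarrow> 'f" assume w: "w \<in> bdd_cont_funs X"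
    then have w': "continuous_map X euclidean w" "bounded (w ` topspace X)"
      by (simp_all add: bdd_cont_funs_def cont_funs_def)
    obtain u :: "nat \<Rightarrow> 'a \<Rightarrow> 'f" and K where u: "\<And>n. simple_fun X (u n)"
        "uniform_limit (topspace X) u w sequentially"
        "0 < K" "\<And>n x. x \<in> topspace X \<Longrightarrow> norm (u n x) \<le> K"
      using bounded_continuous_uniform_limit[OF w'] by blast
    from tendsto_diff[OF simple_int_transport_tendsto[OF u] density_charge_uniform_limit(2)[OF s u]]
    have "(\<lambda>n. simple_int X transport (u n) - simple_int X (density_charge \<rho>) (u n)) \<longlonglongrightarrow> 0"
      by (simp add: eq[OF w])
    moreover have "simple_int X \<Delta> v = simple_int X transport v - simple_int X (density_charge \<rho>) v" for v
      by (simp add: simple_int_def \<Delta>_def right_diff_distrib sum_subtractf)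
    moreover have "(\<lambda>n. simple_int X \<Delta> (u n)) \<longlonglongrightarrow> int_over X \<Delta> w"
      by (rule \<Delta>.determining_tendsto_int_over[OF \<Delta>.determining_uniform_limit[OF u]])
    ultimately show "int_over X \<Delta> w = 0"
      using LIMSEQ_unique by simp
  qed
  then show ?thesis
    by (simp add: \<Delta>_def)
qed

end

section \<open>Quasi-invariance with a prescribed factor\<close>

theorem corollary8:
  fixes X :: "'a topology"
    and G :: "('g, 'r) monoid_scheme"
    and act :: "'g \<Rightarrow> 'a \<Rightarrow> 'a"
    and d :: "'g \<Rightarrow> 'a \<Rightarrow> 'f::{real_normed_field, euclidean_space}"
    and m :: "'a set \<Rightarrow> 'f"
  assumes "Tychonoff_space X"
    and "group_action G (topspace X) act"
    and "\<forall>g\<in>carrier G. \<forall>A\<in>zero_set_algebra X. act g ` A \<in> zero_set_algebra X"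
    and "\<forall>g\<in>carrier G. act g ` topspace X = topspace X"
    and "\<forall>g\<in>carrier G. continuous_map X X (act g)"
    and "\<forall>g\<in>carrier G. continuous_map X euclidean (d g)"
    and "\<forall>x\<in>topspace X. d \<one>\<^bsub>G\<^esub> x = 1"
    and "\<forall>g\<in>carrier G. \<forall>x\<in>topspace X. d g x \<noteq> 0"
    and "\<forall>s\<in>carrier G. \<forall>g\<in>carrier G. \<forall>x\<in>topspace X.
           d (s \<otimes>\<^bsub>G\<^esub> g) x = d g (act (inv\<^bsub>G\<^esub> s) x) * d s x"
    and "m \<in> reg_measures X"
  shows "(\<forall>f\<in>bdd_cont_funs X. \<forall>h\<in>cont_funs X. related X G act d f h \<longrightarrow>
            int_exists X m f \<and> int_exists X m h \<and> int_over X m f = int_over X m h)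
         \<longleftrightarrow> m \<in> quasi_invariant_measures X G act d"
proof -
  interpret ga: group_action G "topspace X" act
    by (rule assms(2))
  interpret grp: Group.group G
    using assms(2) by (simp add: group_action_def group_hom_def)
  interpret bounded_charge X m
    using assms(10) by (simp add: reg_measures_def bounded_charge_def)
  have reg: "\<exists>Z\<in>zero_sets X. Z \<subseteq> A \<and> variation X m (A - Z) < \<epsilon>"
    if "A \<in> zero_set_algebra X" "0 < \<epsilon>" for A \<epsilon>
    using assms(10) that by (simp add: reg_measures_def)
  have act_in: "act g x \<in> topspace X" if "g \<in> carrier G" "x \<in> topspace X" for g x
    using assms(4) that by blast
  have act_inv: "act g (act (inv\<^bsub>G\<^esub> g) x) = x" if "g \<in> carrier G" "x \<in> topspace X" for g x
  proof -
    have "act g (act (inv\<^bsub>G\<^esub> g) x) = act \<one>\<^bsub>G\<^esub> x"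
      using ga.composition_rule[OF that(2,1) grp.inv_closed[OF that(1)]] that by simp
    also have "\<dots> = x"
      using that(2) ga.id_eq_one[symmetric] by simp
    finally show ?thesis .
  qed
  have inv_act: "act (inv\<^bsub>G\<^esub> g) (act g x) = x" if "g \<in> carrier G" "x \<in> topspace X" for g x
    using act_inv[OF grp.inv_closed[OF that(1)] that(2)] that(1) by simp
  have homeo: "homeomorphic_maps X X (act g) (act (inv\<^bsub>G\<^esub> g))" if "g \<in> carrier G" for g
    using assms(5) that act_inv inv_act by (simp add: homeomorphic_maps_def)
  have tc: "transported_charge X m (act g) (act (inv\<^bsub>G\<^esub> g))" if "g \<in> carrier G" for g
    using assms(3) homeo[OF that] that
    by (simp add: transported_charge_def transported_charge_axioms_def bounded_charge_axioms)
  have cocycle: "d (inv\<^bsub>G\<^esub> g) x * d g (act g x) = 1" if "g \<in> carrier G" "x \<in> topspace X" for g x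
    using assms(7,9) that grp.inv_closed[OF that(1)] grp.l_inv[OF that(1)] grp.inv_inv[OF that(1)]
    by (metis mult.commute)
  have bdd_act: "(\<lambda>x. w (act g x)) \<in> bdd_cont_funs X"
    if g: "g \<in> carrier G" and w: "w \<in> bdd_cont_funs X" for g and w :: "'a \<Rightarrow> 'f"
  proof -
    have "continuous_map X euclidean (w \<circ> act g)"
      using assms(5) g w by (intro continuous_map_compose[of X X]) (simp_all add: bdd_cont_funs_def cont_funs_def)
    moreover have "bounded ((\<lambda>x. w (act g x)) ` topspace X)"
      using w act_in[OF g] unfolding bdd_cont_funs_def by (auto elim!: bounded_subset)
    ultimately show ?thesis
      by (simp add: bdd_cont_funs_def cont_funs_def comp_def)
  qed
  show ?thesis
  proof
    assume H: "\<forall>f\<in>bdd_cont_funs X. \<forall>h\<in>cont_funs X. related X G act d f h \<longrightarrow>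
        int_exists X m f \<and> int_exists X m h \<and> int_over X m f = int_over X m h"
    \<comment> \<open>The function \<^term>\<open>\<lambda>x. w (act g x)\<close> is related, through the inverse of \<^term>\<open>g\<close>, to the function
      \<^term>\<open>\<lambda>x. w x * d g x\<close>.\<close>
    have key: "int_exists X m (\<lambda>x. w x * d g x)"
        "int_over X m (\<lambda>x. w (act g x)) = int_over X m (\<lambda>x. w x * d g x)"
      if g: "g \<in> carrier G" and w: "w \<in> bdd_cont_funs X" for g w
    proof -
      have "continuous_map X euclidean (\<lambda>x. w x * d g x)"
        using w assms(6) g by (simp add: bdd_cont_funs_def cont_funs_def continuous_map_atin tendsto_mult)
      then have "(\<lambda>x. w x * d g x) \<in> cont_funs X"
        by (simp add: cont_funs_def)
      moreover have "related X G act d (\<lambda>x. w (act g x)) (\<lambda>x. w x * d g x)"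
        unfolding related_def
      proof (intro bexI ballI)
        fix x assume x: "x \<in> topspace X"
        have "d (inv\<^bsub>G\<^esub> g) x * (w (act g x) * d g (act g x)) = w (act g x) * (d (inv\<^bsub>G\<^esub> g) x * d g (act g x))"
          by (simp only: mult_ac)
        then show "w (act g x) = d (inv\<^bsub>G\<^esub> g) x *
            (w (act (inv\<^bsub>G\<^esub> (inv\<^bsub>G\<^esub> g)) x) * d g (act (inv\<^bsub>G\<^esub> (inv\<^bsub>G\<^esub> g)) x))"
          using cocycle[OF g x] g by simp
      qed (use g in simp)
      ultimately show "int_exists X m (\<lambda>x. w x * d g x)"
          "int_over X m (\<lambda>x. w (act g x)) = int_over X m (\<lambda>x. w x * d g x)"
        using H bdd_act[OF g w] by blast+
    qed
    \<comment> \<open>Taking \<^term>\<open>w\<close> constantly one shows that \<^term>\<open>d g\<close> is integrable.\<close>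
    have "\<exists>s. determining s (d g)" if g: "g \<in> carrier G" for g
    proof -
      have "(\<lambda>x. 1 :: 'f) \<in> bdd_cont_funs X"
        by (auto simp: bdd_cont_funs_def cont_funs_def bounded_iff)
      from key(1)[OF g this] show ?thesis
        using int_exists_iff_determining by simp
    qed
    then obtain S where S: "\<And>g. g \<in> carrier G \<Longrightarrow> determining (S g) (d g)"
      by metis
    have eq: "m (act (inv\<^bsub>G\<^esub> g) ` A) = density_charge (d g) A"
      if g: "g \<in> carrier G" and A: "A \<in> zero_set_algebra X" for g A
      using transported_charge.transport_eq_density_charge[OF tc[OF g] reg S[OF g] key(2)[OF g] A] .
    have "has_density X (translate G act m g) m (d g)" if g: "g \<in> carrier G" for g
      unfolding has_density_def
    proof (intro ballI conjI)
      fix A assume A: "A \<in> zero_set_algebra X"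
      show "int_exists X m (\<lambda>x. indicator A x *\<^sub>R d g x)"
        using determining_indicator[OF S[OF g] A] int_exists_iff_determining by blast
      show "translate G act m g A = int_over X m (\<lambda>x. indicator A x *\<^sub>R d g x)"
        using eq[OF g A] by (simp add: translate_def density_charge_def)
    qed
    moreover have "almost_all X m (\<lambda>x. d g x = d g x)" for g
      using outer_variation_empty by (simp add: almost_all_def)
    moreover have "quasi_invariant X G act m"
      unfolding quasi_invariant_def equivalent_measures_def
    proof (intro ballI)
      fix g A assume g: "g \<in> carrier G" and A: "A \<in> zero_set_algebra X"
      have translate: "translate G act m g = (\<lambda>A. m (act (inv\<^bsub>G\<^esub> g) ` A))"
        by (rule ext) (simp add: translate_def)
      interpret T: bounded_charge X "translate G act m g"
        unfolding translate by (rule transported_charge.transport_charge[OF tc[OF g]])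
      have null: "m (act (inv\<^bsub>G\<^esub> k) ` B) = 0"
        if "k \<in> carrier G" "B \<in> zero_set_algebra X" "variation X m B = 0" for k B
        using eq[OF that(1,2)] density_charge_null[OF S[OF that(1)] that(2,3)] by simp
      show "variation X (translate G act m g) A = 0 \<longleftrightarrow> variation X m A = 0"
      proof
        assume 0: "variation X m A = 0"
        show "variation X (translate G act m g) A = 0"
          unfolding T.variation_eq_0_iff[OF A]
        proof (intro ballI impI)
          fix B assume B: "B \<in> zero_set_algebra X" "B \<subseteq> A"
          have "variation X m B = 0"
            using variation_mono[OF B(1) A B(2)] variation_nonneg[OF B(1)] 0 by simp
          from null[OF g B(1) this] show "translate G act m g B = 0"
            by (simp add: translate)
        qed
      next
        assume 0: "variation X (translate G act m g) A = 0"
        show "variation X m A = 0"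
          unfolding variation_eq_0_iff[OF A]
        proof (intro ballI impI)
          fix B assume B: "B \<in> zero_set_algebra X" "B \<subseteq> A"
          let ?i = "act (inv\<^bsub>G\<^esub> g)"
          have iB: "?i ` B \<in> zero_set_algebra X"
            using assms(3) g B(1) by simp
          have BX: "B \<subseteq> topspace X"
            by (rule zsa.sets_into_space[OF B(1)])
          \<comment> \<open>The converse implication is the first one for the inverse of \<^term>\<open>g\<close>, applied to the
            image of \<^term>\<open>B\<close>.\<close>
          have "variation X m (?i ` B) = 0"
            unfolding variation_eq_0_iff[OF iB]
          proof (intro ballI impI)
            fix C assume C: "C \<in> zero_set_algebra X" "C \<subseteq> ?i ` B"
            have gC: "act g ` C \<in> zero_set_algebra X"
              using assms(3) g C(1) by simp
            have "act g ` C \<subseteq> act g ` ?i ` B"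
              using C(2) by (rule image_mono)
            also have "act g ` ?i ` B = B"
              using act_inv[OF g] BX by (force simp: image_image)
            finally have "act g ` C \<subseteq> A"
              using B(2) by simp
            then have "translate G act m g (act g ` C) = 0"
              using 0 gC T.variation_eq_0_iff[OF A] by blast
            moreover have "?i ` act g ` C = C"
              using inv_act[OF g] zsa.sets_into_space[OF C(1)] by (force simp: image_image)
            ultimately show "m C = 0"
              by (simp add: translate)
          qed
          from null[OF grp.inv_closed[OF g] iB this]
          have "m (act g ` ?i ` B) = 0"
            using g by simp
          moreover have "act g ` ?i ` B = B"
            using act_inv[OF g] BX by (force simp: image_image)
          ultimately show "m B = 0"
            by simp
        qed
      qed
    qed
    ultimately show "m \<in> quasi_invariant_measures X G act d"
      using assms(10) unfolding quasi_invariant_measures_def by blast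
  next
    assume Q: "m \<in> quasi_invariant_measures X G act d"
    then obtain dm where dm: "\<And>g. g \<in> carrier G \<Longrightarrow> has_density X (translate G act m g) m (dm g)"
        "\<And>g. g \<in> carrier G \<Longrightarrow> almost_all X m (\<lambda>x. dm g x = d g x)"
      unfolding quasi_invariant_measures_def by blast
    show "\<forall>f\<in>bdd_cont_funs X. \<forall>h\<in>cont_funs X. related X G act d f h \<longrightarrow>
        int_exists X m f \<and> int_exists X m h \<and> int_over X m f = int_over X m h"
    proof (intro ballI impI)
      fix f h assume f: "f \<in> bdd_cont_funs X" and "related X G act d f h"
      then obtain g where g: "g \<in> carrier G"
          "\<And>x. x \<in> topspace X \<Longrightarrow> f x = d g x * h (act (inv\<^bsub>G\<^esub> g) x)"
        by (auto simp: related_def)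
      \<comment> \<open>By the cocycle identity \<^term>\<open>h x = d j x * f (act g x)\<close> for the inverse \<^term>\<open>j\<close> of
        \<^term>\<open>g\<close>, so the density of the transport by \<^term>\<open>j\<close> is the one that matters.\<close>
      define j where "j = inv\<^bsub>G\<^esub> g"
      have j: "j \<in> carrier G" "inv\<^bsub>G\<^esub> j = g"
        using g(1) by (simp_all add: j_def)
      have ae: "outer_variation X m {x \<in> topspace X. dm j x \<noteq> d j x} = 0"
        using dm(2)[OF j(1)] by (simp add: almost_all_def)
      have cut: "int_exists X m (\<lambda>x. indicator A x *\<^sub>R d j x)"
          "int_over X m (\<lambda>x. indicator A x *\<^sub>R d j x) = m (act g ` A)"
        if A: "A \<in> zero_set_algebra X" for A
      proof -
        have *: "int_exists X m (\<lambda>x. indicator A x *\<^sub>R dm j x)"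
            "m (act g ` A) = int_over X m (\<lambda>x. indicator A x *\<^sub>R dm j x)"
          using dm(1)[OF j(1)] A by (simp_all add: has_density_def translate_def j(2))
        have "outer_variation X m {x \<in> topspace X. indicator A x *\<^sub>R dm j x \<noteq> indicator A x *\<^sub>R d j x}
            \<le> outer_variation X m {x \<in> topspace X. dm j x \<noteq> d j x}"
          by (intro outer_variation_mono) auto
        moreover have "0 \<le> outer_variation X m {x \<in> topspace X. indicator A x *\<^sub>R dm j x \<noteq> indicator A x *\<^sub>R d j x}"
          by (rule outer_variation_nonneg) auto
        ultimately have 0: "outer_variation X m {x \<in> topspace X. indicator A x *\<^sub>R dm j x \<noteq> indicator A x *\<^sub>R d j x} = 0"
          using ae by simp
        from int_cong_ae[OF *(1) 0]
        show "int_exists X m (\<lambda>x. indicator A x *\<^sub>R d j x)"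
            "int_over X m (\<lambda>x. indicator A x *\<^sub>R d j x) = m (act g ` A)"
          using *(2) by simp_all
      qed
      have "int_exists X m (d j)"
        by (rule int_cong(1)[OF cut(1)[OF zsa.top]]) simp
      then obtain s where s: "determining s (d j)"
        using int_exists_iff_determining by blast
      have w: "(\<lambda>x. f (act g x)) \<in> bdd_cont_funs X"
        by (rule bdd_act[OF g(1) f])
      have "m (act g ` A) = density_charge (d j) A" if "A \<in> zero_set_algebra X" for A
        using cut(2)[OF that] by (simp add: density_charge_def)
      note I = transported_charge.int_transport_density[OF tc[OF j(1)] s, unfolded j(2), OF this,
          of "\<lambda>x. f (act g x)"]
      have I1: "int_exists X m (\<lambda>x. f (act g x) * d j x)"
        using w by (intro I) (simp_all add: bdd_cont_funs_def cont_funs_def)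
      have I2: "int_over X m (\<lambda>x. f (act g (act j x))) = int_over X m (\<lambda>x. f (act g x) * d j x)"
        using w by (intro I) (simp_all add: bdd_cont_funs_def cont_funs_def)
      have f_int: "int_exists X m f"
        using f by (intro int_bounded_continuous) (simp_all add: bdd_cont_funs_def cont_funs_def)
      have f_eq: "int_over X m (\<lambda>x. f (act g (act j x))) = int_over X m f"
        using act_inv[OF g(1)] by (intro int_cong(2)[OF f_int]) (simp add: j_def)
      have h: "f (act g x) * d j x = h x" if x: "x \<in> topspace X" for x
      proof -
        have "f (act g x) = d g (act g x) * h x"
          using g(2)[OF act_in[OF g(1) x]] inv_act[OF g(1) x] by simp
        then show ?thesis
          using cocycle[OF g(1) x] by (simp add: j_def mult_ac)
      qed
      show "int_exists X m f \<and> int_exists X m h \<and> int_over X m f = int_over X m h"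
        using f_int int_cong[OF I1 h] I2 f_eq by simp
    qed
  qed
qed

end
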